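(* Let $N\in\mathbb{Z}$ and let $\mathrm{BS}(N,N)=\langle a,t\mid t a^N t^{-1}=a^N\rangle$. For every finite (monoid) generating set $X$ of $\mathrm{BS}(N,N)$ and every regular language $R\subseteq X^*$, the cogrowth series $C_R(z)$ of $\mathrm{BS}(N,N)$ is the diagonal of a rational function; that is, there are an integer $p\geq 1$ and a rational power series $r(x_1,\ldots,x_p)\in\mathbb{Q}[[x_1,\ldots,x_p]]$ such that $C_R(z)=\mathrm{Diag}(r)(z)$.
   Context: $\mathbb{N}=\{0,1,2,\ldots\}$. A finite monoid generating set $X$ of a group $G$ is a finite set of elements generating $G$ as a monoid; $X^*$ is the set of all words over $X$; for $w\in X^*$, $|w|_X$ is its length as a word and $\overline{w}\in G$ is the element it represents. A language $R\subseteq X^*$ is regular if it is accepted by a finite-state automaton. The cogrowth series of $G$ with respect to $R$ is $C_R(z)=\sum_{k=0}^\infty c_k z^k\in\mathbb{N}[[z]]$, where $c_k=\#\{w\in R\mid |w|_X=k \text{ and } \overline{w}=1\}$. A power series $f(\mathbf{x})\in\mathbb{Q}[[\mathbf{x}]]$ in variables $\mathbf{x}=(x_1,\ldots,x_p)$ is rational if there are polynomials $P,Q\in\mathbb{Z}[\mathbf{x}]$ with $f=P/Q$. The (complete) diagonal of $f(\mathbf{x})=\sum_{k_1,\ldots,k_p\in\mathbb{N}}a(k_1,\ldots,k_p)x_1^{k_1}\cdots x_p^{k_p}$ is the univariate power series $\mathrm{Diag}(f)(z)=\sum_{k\in\mathbb{N}}a(k,k,\ldots,k)z^k$. *)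

theory Defs
  imports
    "HOL-Algebra.Group"
    "HOL-Library.Poly_Mapping"
    "HOL-Computational_Algebra.Formal_Power_Series"
begin

section \<open>Groups given by generators and relations\<close>

text \<open>The letter \<open>(x, True)\<close> stands for the generator \<open>x\<close>, the letter \<open>(x, False)\<close> for its formal
  inverse.\<close>

type_synonym 'g word = "('g \<times> bool) list"

inductive pres_eq :: "('g word \<times> 'g word) set \<Rightarrow> 'g word \<Rightarrow> 'g word \<Rightarrow> bool"
  for rels :: "('g word \<times> 'g word) set" where
  refl: "pres_eq rels u u"
| sym: "pres_eq rels u v \<Longrightarrow> pres_eq rels v u"
| trans: "pres_eq rels u v \<Longrightarrow> pres_eq rels v w \<Longrightarrow> pres_eq rels u w"
| cancel: "pres_eq rels (u @ [(x, b), (x, \<not> b)] @ v) (u @ v)"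
| rel: "(l, r) \<in> rels \<Longrightarrow> pres_eq rels (u @ l @ v) (u @ r @ v)"

definition pres_class :: "('g word \<times> 'g word) set \<Rightarrow> 'g word \<Rightarrow> 'g word set" where
  "pres_class rels u = {v. pres_eq rels u v}"

text \<open>The group generated by all elements of the type \<open>'g\<close> subject to the relations \<open>l = r\<close>
  for \<open>(l, r) \<in> rels\<close>.\<close>

definition presented_group :: "('g word \<times> 'g word) set \<Rightarrow> 'g word set monoid" where
  "presented_group rels =
     \<lparr> carrier = range (pres_class rels),
       monoid.mult = (\<lambda>A B. \<Union>u\<in>A. \<Union>v\<in>B. pres_class rels (u @ v)),
       monoid.one = pres_class rels [] \<rparr>"

lemma pres_eq_append_left: "pres_eq rels u v \<Longrightarrow> pres_eq rels (w @ u) (w @ v)"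
proof (induction rule: pres_eq.induct)
  case (cancel u x b v)
  show ?case using pres_eq.cancel[of rels "w @ u" x b v] by simp
next
  case (rel l r u v)
  then show ?case using pres_eq.rel[of l r rels "w @ u" v] by simp
qed (blast intro: pres_eq.refl pres_eq.sym pres_eq.trans)+

lemma pres_eq_append_right: "pres_eq rels u v \<Longrightarrow> pres_eq rels (u @ w) (v @ w)"
proof (induction rule: pres_eq.induct)
  case (cancel u x b v)
  show ?case using pres_eq.cancel[of rels u x b "v @ w"] by simp
next
  case (rel l r u v)
  then show ?case using pres_eq.rel[of l r rels u "v @ w"] by simp
qed (blast intro: pres_eq.refl pres_eq.sym pres_eq.trans)+

lemma pres_class_eq_iff: "pres_class rels u = pres_class rels v \<longleftrightarrow> pres_eq rels u v"
  unfolding pres_class_def set_eq_iff mem_Collect_eq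
  by (meson pres_eq.refl pres_eq.sym pres_eq.trans)

lemma presented_group_mult:
  "pres_class rels u \<otimes>\<^bsub>presented_group rels\<^esub> pres_class rels v = pres_class rels (u @ v)"
proof -
  let ?U = "pres_class rels u" and ?V = "pres_class rels v"
  have eq: "pres_class rels (u' @ v') = pres_class rels (u @ v)" if "u' \<in> ?U" "v' \<in> ?V" for u' v'
  proof -
    have "pres_eq rels (u @ v) (u' @ v)" "pres_eq rels (u' @ v) (u' @ v')"
      using that by (simp_all add: pres_class_def pres_eq_append_left pres_eq_append_right)
    then show ?thesis using pres_class_eq_iff pres_eq.trans by blast
  qed
  have "(\<Union>u'\<in>?U. \<Union>v'\<in>?V. pres_class rels (u' @ v'))
      = (\<Union>u'\<in>?U. \<Union>v'\<in>?V. pres_class rels (u @ v))"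
    by (intro SUP_cong HOL.refl eq)
  moreover have "u \<in> ?U" "v \<in> ?V"
    by (simp_all add: pres_class_def pres_eq.refl)
  ultimately show ?thesis unfolding presented_group_def by auto
qed

definition word_inv :: "'g word \<Rightarrow> 'g word" where
  "word_inv u = rev (map (\<lambda>(x, b). (x, \<not> b)) u)"

lemma pres_eq_word_inv: "pres_eq rels (word_inv u @ u) []"
proof (induction u)
  case Nil
  show ?case by (simp add: word_inv_def pres_eq.refl)
next
  case (Cons l u)
  obtain x b where l: "l = (x, b)" by (cases l)
  have "pres_eq rels (word_inv (l # u) @ l # u) (word_inv u @ u)"
    using pres_eq.cancel[of rels "word_inv u" x "\<not> b" u] by (simp add: word_inv_def l)
  then show ?case using Cons.IH by (rule pres_eq.trans)
qed

lemma group_presented_group: "group (presented_group rels)"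
proof (rule groupI)
  fix x assume "x \<in> carrier (presented_group rels)"
  then obtain u where u: "x = pres_class rels u" by (auto simp: presented_group_def)
  have one: "\<one>\<^bsub>presented_group rels\<^esub> = pres_class rels []" by (simp add: presented_group_def)
  show "\<one>\<^bsub>presented_group rels\<^esub> \<otimes>\<^bsub>presented_group rels\<^esub> x = x"
    by (simp add: u one presented_group_mult)
  have "pres_class rels (word_inv u) \<otimes>\<^bsub>presented_group rels\<^esub> x = \<one>\<^bsub>presented_group rels\<^esub>"
    by (simp add: u one presented_group_mult pres_class_eq_iff pres_eq_word_inv)
  then show "\<exists>y\<in>carrier (presented_group rels).
      y \<otimes>\<^bsub>presented_group rels\<^esub> x = \<one>\<^bsub>presented_group rels\<^esub>"
    by (force simp: presented_group_def)
next
  fix x y assume "x \<in> carrier (presented_group rels)" "y \<in> carrier (presented_group rels)"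
  then obtain u v where "x = pres_class rels u" "y = pres_class rels v"
    by (auto simp: presented_group_def)
  then show "x \<otimes>\<^bsub>presented_group rels\<^esub> y \<in> carrier (presented_group rels)"
    by (simp add: presented_group_mult) (simp add: presented_group_def)
next
  fix x y z
  assume "x \<in> carrier (presented_group rels)" "y \<in> carrier (presented_group rels)"
    "z \<in> carrier (presented_group rels)"
  then obtain u v w where
    "x = pres_class rels u" "y = pres_class rels v" "z = pres_class rels w"
    by (auto simp: presented_group_def)
  then show "x \<otimes>\<^bsub>presented_group rels\<^esub> y \<otimes>\<^bsub>presented_group rels\<^esub> z =
      x \<otimes>\<^bsub>presented_group rels\<^esub> (y \<otimes>\<^bsub>presented_group rels\<^esub> z)"
    by (simp add: presented_group_mult)
qed (simp add: presented_group_def)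


section \<open>Baumslag--Solitar groups\<close>

datatype bs_gen = Gen_a | Gen_t

definition gen_power :: "'g \<Rightarrow> int \<Rightarrow> 'g word" where
  "gen_power x n =
     (if n \<ge> 0 then replicate (nat n) (x, True) else replicate (nat (- n)) (x, False))"

definition BS :: "int \<Rightarrow> int \<Rightarrow> bs_gen word set monoid" where
  "BS M N = presented_group
     {(gen_power Gen_t 1 @ gen_power Gen_a M @ gen_power Gen_t (- 1), gen_power Gen_a N)}"


section \<open>Words, monoid generating sets, regular languages\<close>

definition word_value :: "('x, 'm) monoid_scheme \<Rightarrow> 'x list \<Rightarrow> 'x" where
  "word_value G w = foldr (\<otimes>\<^bsub>G\<^esub>) w \<one>\<^bsub>G\<^esub>"

definition monoid_generating_set :: "('x, 'm) monoid_scheme \<Rightarrow> 'x set \<Rightarrow> bool" where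
  "monoid_generating_set G X \<longleftrightarrow> X \<subseteq> carrier G \<and> carrier G = word_value G ` lists X"

text \<open>Acceptance by a deterministic finite automaton over the alphabet \<open>X\<close>; up to renaming,
  the states are natural numbers.\<close>

definition regular_language :: "'x set \<Rightarrow> 'x list set \<Rightarrow> bool" where
  "regular_language X R \<longleftrightarrow>
     (\<exists>(S :: nat set) (q0 :: nat) (F :: nat set) (\<delta> :: nat \<Rightarrow> 'x \<Rightarrow> nat).
        finite S \<and> q0 \<in> S \<and> F \<subseteq> S \<and> (\<forall>q\<in>S. \<forall>x\<in>X. \<delta> q x \<in> S) \<and>
        R = {w \<in> lists X. foldl \<delta> q0 w \<in> F})"

definition cogrowth_series :: "('x, 'm) monoid_scheme \<Rightarrow> 'x list set \<Rightarrow> rat fps" where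
  "cogrowth_series G R =
     Abs_fps (\<lambda>k. of_nat (card {w \<in> R. length w = k \<and> word_value G w = \<one>\<^bsub>G\<^esub>}))"


section \<open>Multivariate rational power series and diagonals\<close>

text \<open>The variables are \<open>x\<^sub>0, x\<^sub>1, \<dots>\<close>; a monomial is its finitely supported exponent vector. A power
  series in the first \<open>p\<close> variables is a coefficient function that vanishes on every monomial
  involving another variable, and likewise for polynomials.\<close>

type_synonym monomial = "nat \<Rightarrow>\<^sub>0 nat"

definition is_mps :: "nat \<Rightarrow> (monomial \<Rightarrow> 'c::zero) \<Rightarrow> bool" where
  "is_mps p f \<longleftrightarrow> (\<forall>m. f m \<noteq> 0 \<longrightarrow> Poly_Mapping.keys m \<subseteq> {..<p})"

definition mps_mult ::
    "(monomial \<Rightarrow> 'c::comm_semiring_0) \<Rightarrow> (monomial \<Rightarrow> 'c) \<Rightarrow> monomial \<Rightarrow> 'c" where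
  "mps_mult f g m = (\<Sum>(i, j) \<in> {(i, j). i + j = m}. f i * g j)"

definition mps_of_poly :: "(monomial \<Rightarrow>\<^sub>0 int) \<Rightarrow> monomial \<Rightarrow> rat" where
  "mps_of_poly P m = of_int (Poly_Mapping.lookup P m)"

text \<open>\<open>f = P / Q\<close> is read as \<open>Q \<noteq> 0\<close> and \<open>Q * f = P\<close> in the ring of power series, which is an
  integral domain.\<close>

definition rational_mps :: "nat \<Rightarrow> (monomial \<Rightarrow> rat) \<Rightarrow> bool" where
  "rational_mps p f \<longleftrightarrow> is_mps p f \<and>
     (\<exists>P Q :: monomial \<Rightarrow>\<^sub>0 int.
        is_mps p (Poly_Mapping.lookup P) \<and> is_mps p (Poly_Mapping.lookup Q) \<and> Q \<noteq> 0 \<and>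
        mps_mult (mps_of_poly Q) f = mps_of_poly P)"

definition diagonal :: "nat \<Rightarrow> (monomial \<Rightarrow> 'c) \<Rightarrow> 'c fps" where
  "diagonal p f = Abs_fps (\<lambda>k. f (\<Sum>i<p. Poly_Mapping.single i k))"

text \<open>The index set in \<open>mps_mult\<close> is finite, so the sum is never a default value.\<close>

lemma finite_monomial_splits: "finite {(i, j). i + j = (m :: monomial)}"
proof -
  let ?l = "Poly_Mapping.lookup" and ?K = "Poly_Mapping.keys m"
  let ?S = "{(i, j). i + j = m}"
  define B where "B = {h. \<forall>x. (x \<in> ?K \<longrightarrow> h x \<in> (\<Union>y\<in>?K. {..?l m y})) \<and> (x \<notin> ?K \<longrightarrow> h x = 0)}"
  have finB: "finite B" unfolding B_def by (rule finite_set_of_finite_funs) auto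
  have lB: "?l i \<in> B" if "i + j = m" for i j
  proof -
    have le: "?l i x \<le> ?l m x" for x using that by (auto simp: lookup_add)
    have "?l i x = 0" if "x \<notin> ?K" for x using le[of x] that by (simp add: in_keys_iff)
    moreover have "?l i x \<in> (\<Union>y\<in>?K. {..?l m y})" if "x \<in> ?K" for x
      using le[of x] that by blast
    ultimately show ?thesis by (simp add: B_def)
  qed
  have "(\<lambda>z. ?l (fst z)) ` ?S \<subseteq> B"
    by (rule image_subsetI) (auto simp: case_prod_beta intro: lB)
  moreover have "inj_on (\<lambda>z. ?l (fst z)) ?S"
    by (rule inj_onI) (auto simp: Poly_Mapping.lookup_inject)
  ultimately show ?thesis using finB by (meson finite_imageD finite_subset)
qed

end

theory Submission
  imports Defs
begin

text \<open>Elements of \<open>BS(N, N)\<close> have normal forms made of a stack of letters and a central exponent.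
  Cutting the stack into blocks and reducing the exponent modulo a large number turns the joint
  run of the automaton for \<open>R\<close> and of the normal form into a pushdown machine in which every letter
  pushes or pops at most one block and changes a counter by \<open>-1\<close>, \<open>0\<close> or \<open>1\<close>. Its runs, weighted by
  \<open>z\<close> for the length and \<open>u\<close> for the counter, satisfy a polynomial system \<open>t\<^sub>i = z \<phi>\<^sub>i(z, u, t)\<close>, and
  the cogrowth series extracts the runs with final counter \<open>0\<close>.

  The unknowns are eliminated one at a time by Lagrange inversion in residue form: if \<open>t = F(z, t)\<close>
  with \<open>F\<close> divisible by \<open>z\<close>, then substituting the solution for \<open>t\<close> in \<open>G\<close> gives the constant term
  in \<open>t\<close> of \<open>G (1 - \<partial>F/\<partial>t) / (1 - F/t)\<close>. So the cogrowth series is a constant term of a rational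
  series in \<open>z\<close> over Laurent polynomials, in which the exponents of each variable are at least \<open>-k\<close>
  at \<open>z\<^sup>k\<close>; substituting for \<open>z\<close> its product with these variables makes it a diagonal.\<close>

text \<open>The subgroup generated by \<open>a^N\<close> is central, with quotient the free product
  of Z/N and Z. In that quotient the word problem needs only a stack, so counting runs gives
  algebraic series. The central exponent adds an unbounded integer that must end at 0, and
  extracting that coefficient can lead out of the algebraic series; this is why diagonals appear.
  Each letter emits its carry plus one, so the emitted counter is never negative, and returning to 0
  means exponent k of u at z^k: a diagonal condition as it stands, with no further residue in u.

  The solution of t = F is never constructed. The constant term formula is taken as the definition
  of the substitution, and two facts control it. It kills multiples of t - F, because the
  denominator 1 - F/t cancels. It maps 1 to 1, because (1 - dF/dt)/(1 - F/t) differs from 1 by a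
  logarithmic derivative, which has no constant term. Division by t - F then reduces everything to
  series free of t.\<close>

unbundle fps_syntax

abbreviation lookup :: "('a \<Rightarrow>\<^sub>0 'b::zero) \<Rightarrow> 'a \<Rightarrow> 'b" where "lookup \<equiv> Poly_Mapping.lookup"
abbreviation keys :: "('a \<Rightarrow>\<^sub>0 'b::zero) \<Rightarrow> 'a set" where "keys \<equiv> Poly_Mapping.keys"

type_synonym lmon = "nat \<Rightarrow>\<^sub>0 int"
type_synonym laurent = "lmon \<Rightarrow>\<^sub>0 int"
type_synonym series = "laurent fps"

text \<open>Summing over arbitrary finite supersets of the supports lets products with
  \<open>ct0 I g\<close> or \<open>theta0 i f\<close>, whose supports shrink, be compared with
  \<open>f * g\<close> over one index set.\<close>

lemma lookup_mult_finite:
  fixes f g :: "'a::comm_monoid_add \<Rightarrow>\<^sub>0 'b::comm_semiring_0"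
  assumes "finite A" "keys f \<subseteq> A" "finite B" "keys g \<subseteq> B"
  shows "lookup (f * g) m = (\<Sum>a\<in>A. \<Sum>b\<in>B. if a + b = m then lookup f a * lookup g b else 0)"
proof -
  have inner: "(\<Sum>q. lookup g q when m = a + q) = (\<Sum>b\<in>B. if a + b = m then lookup g b else 0)" for a
  proof -
    have "(\<Sum>q. lookup g q when m = a + q) = (\<Sum>b\<in>B. lookup g b when m = a + b)"
      using assms(3,4) by (intro Sum_any.expand_superset) (auto simp: subset_iff in_keys_iff)
    also have "\<dots> = (\<Sum>b\<in>B. if a + b = m then lookup g b else 0)"
      by (intro sum.cong) (auto simp: when_def)
    finally show ?thesis .
  qed
  have "lookup (f * g) m = (\<Sum>a\<in>A. lookup f a * (\<Sum>b\<in>B. if a + b = m then lookup g b else 0))"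
    unfolding lookup_mult inner
    using assms(1,2) by (intro Sum_any.expand_superset) (auto simp: subset_iff in_keys_iff dest!: mult_not_zero)
  then show ?thesis
    by (simp add: sum_distrib_left if_distrib cong: if_cong)
qed

lemma keys_mult_subset:
  fixes f g :: "'a::comm_monoid_add \<Rightarrow>\<^sub>0 'b::comm_semiring_0"
  assumes "m \<in> keys (f * g)"
  obtains a b where "a \<in> keys f" "b \<in> keys g" "m = a + b"
  using assms keys_mult[of f g] by blast

section \<open>Graded subrings given by exponent conditions\<close>

text \<open>\<open>M k\<close> is the set of Laurent monomials allowed at z^k. The condition makes
  \<open>supported M\<close> a subring; it is used for independence of variables, for nonnegative
  exponents and for exponents at least -k.\<close>

definition graded :: "(nat \<Rightarrow> 'a::comm_monoid_add set) \<Rightarrow> bool" where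
  "graded M \<longleftrightarrow> 0 \<in> M 0 \<and> (\<forall>j k. \<forall>a\<in>M j. \<forall>b\<in>M k. a + b \<in> M (j + k))"

definition supported :: "(nat \<Rightarrow> lmon set) \<Rightarrow> series set" where
  "supported M = {f. \<forall>k. keys (f $ k) \<subseteq> M k}"

lemma supportedI: "(\<And>k. keys (f $ k) \<subseteq> M k) \<Longrightarrow> f \<in> supported M"
  and supportedD: "f \<in> supported M \<Longrightarrow> keys (f $ k) \<subseteq> M k"
  by (auto simp: supported_def)

lemma supported_mono: "(\<And>k. M k \<subseteq> M' k) \<Longrightarrow> supported M \<subseteq> supported M'"
  by (force simp: supported_def)

lemma supported_0 [simp]: "0 \<in> supported M"
  by (simp add: supported_def)

lemma supported_add: "f \<in> supported M \<Longrightarrow> g \<in> supported M \<Longrightarrow> f + g \<in> supported M"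
  using Poly_Mapping.keys_add by (fastforce simp: supported_def)

lemma supported_uminus: "f \<in> supported M \<Longrightarrow> - f \<in> supported M"
  by (simp add: supported_def)

lemma supported_diff: "f \<in> supported M \<Longrightarrow> g \<in> supported M \<Longrightarrow> f - g \<in> supported M"
  using supported_add[of f M "- g"] by (simp add: supported_uminus)

lemma supported_sum: "(\<And>i. i \<in> I \<Longrightarrow> f i \<in> supported M) \<Longrightarrow> sum f I \<in> supported M"
  by (induction I rule: infinite_finite_induct) (auto intro: supported_add)

lemma supported_1: "graded M \<Longrightarrow> 1 \<in> supported M"
  by (auto simp: supported_def graded_def fps_one_nth)

lemma keys_sum_subset: "(\<And>i. i \<in> I \<Longrightarrow> keys (f i :: laurent) \<subseteq> S) \<Longrightarrow> keys (sum f I) \<subseteq> S"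
  using Poly_Mapping.keys_sum[of f I] by blast

lemma supported_mult_nth:
  fixes f g :: series
  assumes "graded M" "\<And>i. i \<le> k \<Longrightarrow> keys (f $ i) \<subseteq> M i" "\<And>i. i \<le> k \<Longrightarrow> keys (g $ i) \<subseteq> M i"
  shows "keys ((f * g) $ k) \<subseteq> M k"
  unfolding fps_mult_nth
proof (rule keys_sum_subset)
  fix i assume i: "i \<in> {0..k}"
  show "keys (f $ i * g $ (k - i)) \<subseteq> M k"
  proof
    fix m assume "m \<in> keys (f $ i * g $ (k - i))"
    then obtain a b where "a \<in> keys (f $ i)" "b \<in> keys (g $ (k - i))" "m = a + b"
      by (rule keys_mult_subset)
    then have "m \<in> M (i + (k - i))"
      using assms i unfolding graded_def by (metis atLeastAtMost_iff diff_le_self subsetD)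
    then show "m \<in> M k" using i by simp
  qed
qed

lemma supported_mult: "graded M \<Longrightarrow> f \<in> supported M \<Longrightarrow> g \<in> supported M \<Longrightarrow> f * g \<in> supported M"
  by (intro supportedI supported_mult_nth) (auto simp: supported_def)

text \<open>This is 1/(1 - x) for \<open>x $ 0 = 0\<close>. Laurent polynomials are not a field, so
  the inverse \<open>1\<close> of the constant coefficient is supplied explicitly.\<close>

definition geom :: "series \<Rightarrow> series" where
  "geom x = fps_right_inverse (1 - x) 1"

lemma geom: "x $ 0 = 0 \<Longrightarrow> (1 - x) * geom x = 1"
  unfolding geom_def by (rule fps_right_inverse) simp

lemma geom_unique:
  assumes "x $ 0 = 0" "(1 - x) * g = 1"
  shows "g = geom x"
proof -
  have "g = ((1 - x) * geom x) * g" by (simp add: geom[OF assms(1)])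
  also have "\<dots> = ((1 - x) * g) * geom x" by (simp only: mult_ac)
  finally show ?thesis by (simp add: assms(2))
qed

lemma geom_nth_0: "x $ 0 = 0 \<Longrightarrow> geom x $ 0 = 1"
  by (simp add: geom_def)

lemma geom_eq: "x $ 0 = 0 \<Longrightarrow> geom x = 1 + x * geom x"
  using geom[of x] by (simp add: algebra_simps)

text \<open>Because \<open>x $ 0 = 0\<close>, the equation \<open>geom x = 1 + x * geom x\<close>
  expresses each coefficient through earlier ones, so strong induction applies.\<close>

lemma supported_geom:
  assumes M: "graded M" and x: "x \<in> supported M" "x $ 0 = 0"
  shows "geom x \<in> supported M"
proof (rule supportedI)
  fix k show "keys (geom x $ k) \<subseteq> M k"
  proof (induction k rule: less_induct)
    case (less k)
    show ?case
    proof (cases k)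
      case 0
      then show ?thesis using M by (simp add: geom_nth_0[OF x(2)] graded_def)
    next
      case (Suc l)
      have "geom x $ k = (x * geom x) $ k"
        using arg_cong[OF geom_eq[OF x(2)], of "\<lambda>f. f $ k"] Suc by simp
      also have "\<dots> = (\<Sum>i=1..k. x $ i * geom x $ (k - i))"
        by (simp add: fps_mult_nth sum.atLeast_Suc_atMost x(2))
      finally have eq: "geom x $ k = (\<Sum>i=1..k. x $ i * geom x $ (k - i))" .
      have "keys (x $ i * geom x $ (k - i)) \<subseteq> M k" if i: "i \<in> {1..k}" for i
      proof
        fix m assume "m \<in> keys (x $ i * geom x $ (k - i))"
        then obtain a b where ab: "a \<in> keys (x $ i)" "b \<in> keys (geom x $ (k - i))" "m = a + b"
          by (rule keys_mult_subset)
        have "a \<in> M i" using supportedD[OF x(1)] ab(1) by blast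
        moreover have "b \<in> M (k - i)" using less.IH[of "k - i"] ab(2) i by auto
        ultimately have "m \<in> M (i + (k - i))"
          using M ab(3) unfolding graded_def by blast
        then show "m \<in> M k" using i by simp
      qed
      then show ?thesis unfolding eq by (rule keys_sum_subset)
    qed
  qed
qed

section \<open>Constant terms and derivations\<close>

lift_definition ct0 :: "nat set \<Rightarrow> laurent \<Rightarrow> laurent" is
  "\<lambda>I f m. if \<forall>i\<in>I. lookup m i = 0 then f m else 0"
  by (erule finite_subset[rotated]) auto

text \<open>The Euler derivation t d/dt. Unlike d/dt it moves no exponent, so it preserves every
  support condition, and its image has no constant term: this is the vanishing residue of an exact
  differential.\<close>

lift_definition theta0 :: "nat \<Rightarrow> laurent \<Rightarrow> laurent" is
  "\<lambda>i f m. lookup m i * f m"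
  by (erule finite_subset[rotated]) auto

definition CT :: "nat set \<Rightarrow> series \<Rightarrow> series" where
  "CT I F = Abs_fps (\<lambda>k. ct0 I (F $ k))"

definition theta :: "nat \<Rightarrow> series \<Rightarrow> series" where
  "theta i F = Abs_fps (\<lambda>k. theta0 i (F $ k))"

definition tpow :: "nat \<Rightarrow> int \<Rightarrow> series" where
  "tpow i e = fps_const (Poly_Mapping.single (Poly_Mapping.single i e) 1)"

definition pd :: "nat \<Rightarrow> series \<Rightarrow> series" where
  "pd i F = tpow i (- 1) * theta i F"

lemma ct0_add: "ct0 I (f + g) = ct0 I f + ct0 I g"
  by (rule poly_mapping_eqI) (simp add: ct0.rep_eq lookup_add)
lemma ct0_0 [simp]: "ct0 I 0 = 0"
  by (rule poly_mapping_eqI) (simp add: ct0.rep_eq)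
lemma ct0_sum: "ct0 I (sum f A) = (\<Sum>a\<in>A. ct0 I (f a))"
  by (induction A rule: infinite_finite_induct) (simp_all add: ct0_add)
lemma theta0_add: "theta0 i (f + g) = theta0 i f + theta0 i g"
  by (rule poly_mapping_eqI) (simp add: theta0.rep_eq lookup_add algebra_simps)
lemma theta0_0 [simp]: "theta0 I 0 = 0"
  by (rule poly_mapping_eqI) (simp add: theta0.rep_eq)
lemma theta0_sum: "theta0 I (sum f A) = (\<Sum>a\<in>A. theta0 I (f a))"
  by (induction A rule: infinite_finite_induct) (simp_all add: theta0_add)

lemma keys_ct0: "keys (ct0 I f) = {m \<in> keys f. \<forall>i\<in>I. lookup m i = 0}"
  by (auto simp: in_keys_iff ct0.rep_eq split: if_splits)
lemma keys_theta0: "keys (theta0 i f) = {m \<in> keys f. lookup m i \<noteq> 0}"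
  by (auto simp: in_keys_iff theta0.rep_eq)

lemma ct0_mult:
  assumes "keys f \<subseteq> {m. \<forall>i\<in>I. lookup m i = 0}"
  shows "ct0 I (f * g) = f * ct0 I g"
proof (rule poly_mapping_eqI)
  fix m
  have "lookup (f * ct0 I g) m = (\<Sum>a\<in>keys f. \<Sum>b\<in>keys g. if a + b = m then lookup f a * lookup (ct0 I g) b else 0)"
    by (rule lookup_mult_finite) (auto simp: keys_ct0)
  also have "\<dots> = (\<Sum>a\<in>keys f. \<Sum>b\<in>keys g.
      if \<forall>i\<in>I. lookup m i = 0 then if a + b = m then lookup f a * lookup g b else 0 else 0)"
    using assms by (intro sum.cong refl) (auto simp: ct0.rep_eq lookup_add subset_iff)
  also have "\<dots> = lookup (ct0 I (f * g)) m"
    unfolding ct0.rep_eq lookup_mult_finite[OF finite_keys subset_refl finite_keys subset_refl, of f g]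
    by (auto intro!: sum.neutral)
  finally show "lookup (ct0 I (f * g)) m = lookup (f * ct0 I g) m" by simp
qed

lemma theta0_mult: "theta0 i (f * g) = theta0 i f * g + f * theta0 i g"
proof (rule poly_mapping_eqI)
  fix m
  have 1: "lookup (theta0 i f * g) m = (\<Sum>a\<in>keys f. \<Sum>b\<in>keys g. if a + b
      = m then lookup (theta0 i f) a * lookup g b else 0)"
    by (rule lookup_mult_finite) (auto simp: keys_theta0)
  have 2: "lookup (f * theta0 i g) m = (\<Sum>a\<in>keys f. \<Sum>b\<in>keys g. if a + b
      = m then lookup f a * lookup (theta0 i g) b else 0)"
    by (rule lookup_mult_finite) (auto simp: keys_theta0)
  show "lookup (theta0 i (f * g)) m = lookup (theta0 i f * g + f * theta0 i g) m"
    unfolding theta0.rep_eq lookup_add 1 2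
      lookup_mult_finite[OF finite_keys subset_refl finite_keys subset_refl, of f g]
    by (auto simp: sum_distrib_left sum.distrib[symmetric] lookup_add algebra_simps intro!: sum.cong)
qed

lemma ct0_theta0: "i \<in> I \<Longrightarrow> ct0 I (theta0 i f) = 0"
  by (rule poly_mapping_eqI) (auto simp: ct0.rep_eq theta0.rep_eq)

lemma CT_nth [simp]: "CT I F $ k = ct0 I (F $ k)"
  and theta_nth [simp]: "theta i F $ k = theta0 i (F $ k)"
  by (simp_all add: CT_def theta_def)

lemma CT_add: "CT I (F + G) = CT I F + CT I G"
  by (simp add: fps_eq_iff ct0_add)
lemma CT_0 [simp]: "CT I 0 = 0"
  by (simp add: fps_eq_iff)
lemma CT_diff: "CT I (F - G) = CT I F - CT I G"
  using CT_add[of I "F - G" G] by simp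
lemma CT_sum: "CT I (sum f A) = (\<Sum>a\<in>A. CT I (f a))"
  by (induction A rule: infinite_finite_induct) (simp_all add: CT_add)
lemma theta_add: "theta i (F + G) = theta i F + theta i G"
  by (simp add: fps_eq_iff theta0_add)
lemma theta_0 [simp]: "theta i 0 = 0"
  by (simp add: fps_eq_iff)
lemma theta_diff: "theta i (F - G) = theta i F - theta i G"
  using theta_add[of i "F - G" G] by simp

lemma theta_mult: "theta i (F * G) = theta i F * G + F * theta i G"
  by (simp add: fps_eq_iff fps_mult_nth theta0_sum theta0_mult sum.distrib)

lemma theta_1 [simp]: "theta i 1 = 0"
  using theta_mult[of i 1 1] by simp

section \<open>Series free of, or with nonnegative exponents in, chosen variables\<close>

definition expzero :: "nat set \<Rightarrow> nat \<Rightarrow> lmon set" where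
  "expzero I k = {m. \<forall>i\<in>I. lookup m i = 0}"
definition expnn :: "nat set \<Rightarrow> nat \<Rightarrow> lmon set" where
  "expnn I k = {m. \<forall>i\<in>I. lookup m i \<ge> 0}"

lemma graded_expzero [simp]: "graded (expzero I)"
  by (simp add: graded_def expzero_def lookup_add)
lemma graded_expnn [simp]: "graded (expnn I)"
  by (simp add: graded_def expnn_def lookup_add)

lemma supported_CT: "F \<in> supported M \<Longrightarrow> CT I F \<in> supported M"
  by (auto simp: supported_def keys_ct0 subset_iff)
lemma supported_theta: "F \<in> supported M \<Longrightarrow> theta i F \<in> supported M"
  by (auto simp: supported_def keys_theta0 subset_iff)
lemma CT_in_expzero: "CT I F \<in> supported (expzero I)"
  by (auto simp: supported_def keys_ct0 expzero_def)

lemma CT_mult: "F \<in> supported (expzero I) \<Longrightarrow> CT I (F * G) = F * CT I G"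
  by (auto simp: fps_eq_iff fps_mult_nth ct0_sum supported_def expzero_def intro!: sum.cong ct0_mult)

lemma CT_theta: "i \<in> I \<Longrightarrow> CT I (theta i F) = 0"
  by (simp add: fps_eq_iff ct0_theta0)

lemma CT_ident: "F \<in> supported (expzero I) \<Longrightarrow> CT I F = F"
  by (rule fps_ext, rule poly_mapping_eqI)
     (auto simp: ct0.rep_eq supported_def expzero_def in_keys_iff subset_iff)

lemma CT_CT: "CT I (CT J F) = CT (I \<union> J) F"
  by (rule fps_ext, rule poly_mapping_eqI) (auto simp: ct0.rep_eq)

lemma theta_expzero: "F \<in> supported (expzero I) \<Longrightarrow> i \<in> I \<Longrightarrow> theta i F = 0"
  by (rule fps_ext, rule poly_mapping_eqI)
     (auto simp: theta0.rep_eq supported_def expzero_def in_keys_iff subset_iff)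

lemma tpow_mult: "tpow i a * tpow i b = tpow i (a + b)"
  by (simp add: tpow_def mult_single single_add)
lemma tpow_0 [simp]: "tpow i 0 = 1"
  by (simp add: tpow_def)
lemma tpow_cancel [simp]: "tpow i 1 * tpow i (-1) = 1" "tpow i (-1) * tpow i 1 = 1"
  by (simp_all add: tpow_mult)
lemma tpow_cancel' [simp]: "tpow i 1 * (tpow i (-1) * F) = F" "tpow i (-1) * (tpow i 1 * F) = F"
  by (simp_all add: mult.assoc[symmetric])

lemma keys_tpow: "keys (tpow i e $ k) = (if k = 0 then {Poly_Mapping.single i e} else {})"
  by (simp add: tpow_def)

lemma theta_tpow: "theta i (tpow j e) = (if i = j then of_int e * tpow i e else 0)"
proof -
  have "theta i (tpow j e) = fps_const (Poly_Mapping.single (Poly_Mapping.single j e) (if i = j then e else 0))"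
    by (rule fps_ext, rule poly_mapping_eqI)
      (auto simp: tpow_def theta0.rep_eq lookup_single when_def)
  moreover have "of_int e * tpow i e = fps_const (Poly_Mapping.single 0 e * Poly_Mapping.single
      (Poly_Mapping.single i e) 1)"
    unfolding tpow_def fps_const_mult[symmetric] by (metis fps_of_int single_of_int of_int_eq_id id_apply)
  ultimately show ?thesis by (auto simp: mult_single)
qed

lemma tpow_in_expzero: "i \<notin> I \<Longrightarrow> tpow i e \<in> supported (expzero I)"
  by (auto simp: supported_def keys_tpow expzero_def lookup_single when_def)
lemma tpow_in_expnn: "e \<ge> 0 \<or> i \<notin> I \<Longrightarrow> tpow i e \<in> supported (expnn I)"
  by (auto simp: supported_def keys_tpow expnn_def lookup_single when_def)

lemma supported_expzero_expnn: "F \<in> supported (expzero I) \<Longrightarrow> F \<in> supported (expnn I)"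
  by (force simp: supported_def expzero_def expnn_def)

lemma pd_add: "pd i (F + G) = pd i F + pd i G"
  by (simp add: pd_def theta_add algebra_simps)
lemma pd_diff: "pd i (F - G) = pd i F - pd i G"
  by (simp add: pd_def theta_diff algebra_simps)
lemma pd_mult: "pd i (F * G) = pd i F * G + F * pd i G"
  by (simp add: pd_def theta_mult algebra_simps)
lemma pd_1 [simp]: "pd i 1 = 0"
  by (simp add: pd_def)
lemma pd_tpow: "pd j (tpow i 1) = (if i = j then 1 else 0)"
  by (simp add: pd_def theta_tpow)
lemma pd_nth_0: "F $ 0 = 0 \<Longrightarrow> pd i F $ 0 = 0"
  by (simp add: pd_def)
lemma pd_eq_0: "F \<in> supported (expzero I) \<Longrightarrow> i \<in> I \<Longrightarrow> pd i F = 0"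
  by (simp add: pd_def theta_expzero)

lemma fps_X_in_supported: "(\<And>k. 0 \<in> M k) \<Longrightarrow> fps_X \<in> supported M"
  by (auto simp: supported_def fps_X_def)
lemma fps_X_expzero [simp]: "fps_X \<in> supported (expzero I)"
  by (rule fps_X_in_supported) (simp add: expzero_def)
lemma fps_X_expnn [simp]: "fps_X \<in> supported (expnn I)"
  by (rule fps_X_in_supported) (simp add: expnn_def)
lemma supported_1' [simp]: "1 \<in> supported (expzero I)" "1 \<in> supported (expnn I)"
  by (simp_all add: supported_1)

lemma keys_single_mult:
  fixes g :: laurent
  assumes "m \<in> keys (Poly_Mapping.single s 1 * g)"
  obtains b where "b \<in> keys g" "m = s + b"
proof -
  obtain a b where "a \<in> keys (Poly_Mapping.single s (1::int))" "b \<in> keys g" "m = a + b"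
    using assms by (rule keys_mult_subset)
  then show thesis using that by simp
qed

lemma keys_pd:
  assumes "m \<in> keys (pd i F $ k)"
  obtains n where "n \<in> keys (F $ k)" "lookup n i \<noteq> 0" "m = Poly_Mapping.single i (- 1) + n"
proof -
  have "pd i F $ k = Poly_Mapping.single (Poly_Mapping.single i (- 1)) 1 * theta0 i (F $ k)"
    by (simp add: pd_def tpow_def)
  with assms obtain n where "n \<in> keys (theta0 i (F $ k))" "m = Poly_Mapping.single i (- 1) + n"
    by (metis keys_single_mult)
  then show thesis using that by (auto simp: keys_theta0)
qed

text \<open>\<open>theta\<close> removes the monomials with exponent 0 in \<open>i\<close>, so the
  remaining exponents are at least 1 and survive the division by the variable.\<close>

lemma pd_expnn: "F \<in> supported (expnn I) \<Longrightarrow> pd i F \<in> supported (expnn I)"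
proof (rule supportedI, rule subsetI)
  fix k m assume F: "F \<in> supported (expnn I)" and "m \<in> keys (pd i F $ k)"
  then obtain n where n: "n \<in> keys (F $ k)" "lookup n i \<noteq> 0" "m = Poly_Mapping.single i (- 1) + n"
    by (auto elim: keys_pd)
  then have "\<forall>j\<in>I. lookup n j \<ge> 0" using supportedD[OF F] by (auto simp: expnn_def)
  then show "m \<in> expnn I k" using n(2,3) by (force simp: expnn_def lookup_add lookup_single when_def)
qed

lemma pd_expzero: "F \<in> supported (expzero I) \<Longrightarrow> i \<notin> I \<Longrightarrow> pd i F \<in> supported (expzero I)"
  unfolding pd_def by (intro supported_mult tpow_in_expzero supported_theta) auto

lemma geom_partial:
  assumes "x $ 0 = 0"
  shows "geom x = (\<Sum>m<N. x ^ m) + x ^ N * geom x"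
proof (induction N)
  case (Suc N)
  have "x ^ N * geom x = x ^ N + x ^ Suc N * geom x"
    by (subst geom_eq[OF assms]) (simp add: algebra_simps)
  then have "(\<Sum>m<Suc N. x ^ m) + x ^ Suc N * geom x = (\<Sum>m<N. x ^ m) + x ^ N * geom x"
    by (simp only: sum.lessThan_Suc add.assoc)
  then show ?case using Suc by simp
qed simp

lemma fps_power_mult_nth_eq_0:
  fixes x :: "'a::comm_ring_1 fps"
  assumes "x $ 0 = 0" "k < N"
  shows "(x ^ N * h) $ k = 0"
  unfolding fps_mult_nth using startsby_zero_power_prefix[OF assms(1)] assms(2)
  by (intro sum.neutral) auto

text \<open>The series is the Euler derivative of -log(1 - x): termwise,
  \<open>theta i x * x ^ m\<close> is \<open>theta i (x ^ Suc m)\<close> divided by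
  \<open>Suc m\<close>. At z^k only finitely many terms count, since \<open>x ^ Suc k\<close>
  contributes nothing there.\<close>

lemma CT_theta_log:
  assumes x: "x $ 0 = 0" and i: "i \<in> I"
  shows "CT I (theta i x * geom x) = 0"
proof -
  have pow: "theta i (x ^ Suc m) = of_nat (Suc m) * (theta i x * x ^ m)" for m
    by (induction m) (simp_all add: theta_mult algebra_simps)
  have nat: "(of_nat n :: series) \<in> supported (expzero I)" for n
    by (induction n) (auto intro: supported_add)
  have "of_nat (Suc m) * CT I (theta i x * x ^ m) = 0" for m
    unfolding CT_mult[OF nat, symmetric] pow[symmetric] by (rule CT_theta[OF i])
  \<comment> \<open>The coefficients are integers, so \<open>Suc m\<close> is cancelled in an
    integral domain of characteristic 0 rather than inverted.\<close>
  then have zero: "CT I (theta i x * x ^ m) = 0" for m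
    by (metis mult_eq_0_iff of_nat_neq_0)
  show ?thesis
  proof (rule fps_ext)
    fix k
    have "theta i x * geom x = (\<Sum>m<Suc k. theta i x * x ^ m) + x ^ Suc k * (geom x * theta i x)"
      by (subst geom_partial[OF x, of "Suc k"]) (simp only: ring_distribs sum_distrib_left mult_ac)
    then have "CT I (theta i x * geom x) $ k = CT I (x ^ Suc k * (geom x * theta i x)) $ k"
      by (simp only: CT_add CT_sum zero sum.neutral_const add_0)
    also have "\<dots> = 0" by (simp only: CT_nth fps_power_mult_nth_eq_0[OF x lessI] ct0_0)
    finally show "CT I (theta i x * geom x) $ k = 0 $ k" by simp
  qed
qed

section \<open>Eliminating one variable\<close>

text \<open>The coefficients of the quotient of \<open>G\<close> by \<open>t\<^sub>i - F\<close>; as \<open>F\<close> is divisible by \<open>z\<close>, each one is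
  determined by the previous ones.\<close>

fun quot :: "nat \<Rightarrow> series \<Rightarrow> series \<Rightarrow> nat \<Rightarrow> laurent" where
  "quot i F G n = (let h = G $ n + (\<Sum>j<n. F $ (n - j) * quot i F G j)
     in Poly_Mapping.single (Poly_Mapping.single i (- 1)) 1 * (h - ct0 {i} h))"

declare quot.simps [simp del]

locale elimination =
  fixes i :: nat and F :: series
  assumes F: "F \<in> supported (expnn {i})" and F0: "F $ 0 = 0"
begin

text \<open>\<open>L G\<close> stands for the value of \<open>G\<close> at the solution of t = F.
  Taking the residue formula as the definition gives linearity at once; that \<open>L\<close> is a
  substitution is what the following lemmas establish.\<close>

definition L :: "series \<Rightarrow> series" where
  "L G = CT {i} (G * ((1 - pd i F) * geom (tpow i (- 1) * F)))"

lemma x0: "(tpow i e * F) $ 0 = 0"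
  by (simp add: F0)

lemma L_add: "L (G + H) = L G + L H"
  by (simp add: L_def CT_add distrib_right)
lemma L_diff: "L (G - H) = L G - L H"
  by (simp add: L_def CT_diff left_diff_distrib)
lemma L_scale: "C \<in> supported (expzero {i}) \<Longrightarrow> L (C * G) = C * L G"
  by (simp add: L_def CT_mult mult.assoc)
text \<open>With x = F/t one has \<open>1 - pd i F = (1 - x) - theta i x\<close>, so the kernel of
  \<open>L\<close> equals 1 minus the logarithmic derivative treated in
  \<open>CT_theta_log\<close>.\<close>

lemma L_1: "L 1 = 1"
proof -
  let ?x = "tpow i (- 1) * F"
  have "theta i ?x = pd i F - ?x" by (simp add: theta_mult theta_tpow pd_def)
  then have "1 - pd i F = (1 - ?x) - theta i ?x" by simp
  then have "(1 - pd i F) * geom ?x = 1 - theta i ?x * geom ?x"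
    by (simp only: left_diff_distrib[of "1 - ?x"] geom[OF x0])
  then show ?thesis
    using CT_theta_log[OF x0, of i "{i}"] by (simp add: L_def CT_diff CT_ident)
qed

lemma L_ident: "C \<in> supported (expzero {i}) \<Longrightarrow> L C = C"
  using L_scale[of C 1] by (simp add: L_1)

lemma CT_tpow_mult: "G \<in> supported (expnn {i}) \<Longrightarrow> CT {i} (tpow i 1 * G) = 0"
proof (rule fps_ext, rule poly_mapping_eqI)
  fix k m assume G: "G \<in> supported (expnn {i})"
  have "lookup m i \<noteq> 0" if "m \<in> keys ((tpow i 1 * G) $ k)"
  proof -
    have "(tpow i 1 * G) $ k = Poly_Mapping.single (Poly_Mapping.single i 1) 1 * (G $ k)"
      by (simp add: tpow_def)
    from that[unfolded this] obtain n where "n \<in> keys (G $ k)" "m = Poly_Mapping.single i 1 + n"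
      by (rule keys_single_mult)
    then show ?thesis using supportedD[OF G, of k] by (force simp: lookup_add expnn_def)
  qed
  then show "lookup (CT {i} (tpow i 1 * G) $ k) m = lookup (0 $ k) m"
    by (auto simp: ct0.rep_eq in_keys_iff)
qed

text \<open>Writing t - F as t(1 - F/t) cancels the geometric series. What remains is t times a
  series with nonnegative exponents, which has no constant term.\<close>

lemma L_kill:
  assumes K: "K \<in> supported (expnn {i})"
  shows "L ((tpow i 1 - F) * K) = 0"
proof -
  let ?x = "tpow i (- 1) * F"
  have t: "tpow i 1 - F = tpow i 1 * (1 - ?x)" by (simp add: right_diff_distrib)
  have "(tpow i 1 - F) * K * ((1 - pd i F) * geom ?x)
      = tpow i 1 * (K * (1 - pd i F)) * ((1 - ?x) * geom ?x)"
    unfolding t by (simp only: mult_ac)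
  also have "\<dots> = tpow i 1 * (K * (1 - pd i F))" by (simp only: geom[OF x0] mult_1_right)
  finally have eq: "(tpow i 1 - F) * K * ((1 - pd i F) * geom ?x) = tpow i 1 * (K * (1 - pd i F))" .
  have "K * (1 - pd i F) \<in> supported (expnn {i})"
    by (intro supported_mult supported_diff pd_expnn K F) auto
  then show ?thesis unfolding L_def eq by (rule CT_tpow_mult)
qed

text \<open>Weierstrass division by t - F with remainder free of t. At each power of z, the constant
  term of \<open>h n\<close> goes to the remainder and the rest is divided by t; nonnegative
  exponents survive because that rest has exponents at least 1.\<close>

lemma division:
  assumes G: "G \<in> supported (expnn {i})"
  obtains G0 K where "G0 \<in> supported (expzero {i})" "K \<in> supported (expnn {i})" "G = G0 + (tpow i 1 - F) * K"
proof -
  define K where "K = Abs_fps (quot i F G)"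
  define h where "h n = G $ n + (\<Sum>j<n. F $ (n - j) * quot i F G j)" for n
  define G0 where "G0 = Abs_fps (\<lambda>n. ct0 {i} (h n))"
  have K: "K $ n = Poly_Mapping.single (Poly_Mapping.single i (- 1)) 1 * (h n - ct0 {i} (h n))" for n
    by (simp add: K_def h_def Let_def quot.simps[of i F G n])
  have FK: "(F * K) $ n = (\<Sum>j<n. F $ (n - j) * quot i F G j)" for n
  proof -
    have "(F * K) $ n = (\<Sum>j\<le>n. K $ j * F $ (n - j))"
      by (subst mult.commute) (simp add: fps_mult_nth atMost_atLeast0)
    also have "\<dots> = (\<Sum>j<n. K $ j * F $ (n - j))"
    proof -
      have "{..n} = insert n {..<n}" by auto
      then show ?thesis by (simp add: F0)
    qed
    finally show ?thesis by (simp add: K_def mult.commute)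
  qed
  have h: "h n = G $ n + (F * K) $ n" for n by (simp add: FK h_def)
  have "G $ n = (G0 + (tpow i 1 - F) * K) $ n" for n
  proof -
    have "(tpow i 1 * K) $ n = Poly_Mapping.single (Poly_Mapping.single i 1) 1
        * Poly_Mapping.single (Poly_Mapping.single i (- 1)) 1 * (h n - ct0 {i} (h n))"
      unfolding tpow_def fps_mult_left_const_nth K by (simp only: mult.assoc)
    then have "(tpow i 1 * K) $ n = h n - ct0 {i} (h n)"
      unfolding mult_single single_add[symmetric] by simp
    then show ?thesis by (simp add: left_diff_distrib G0_def h)
  qed
  then have eq: "G = G0 + (tpow i 1 - F) * K" by (rule fps_ext)
  have keysK: "keys (K $ n) \<subseteq> expnn {i} n" for n
  proof (induction n rule: less_induct)
    case (less n)
    have "keys ((F * K) $ n) \<subseteq> expnn {i} n"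
      unfolding FK
    proof (rule keys_sum_subset, rule subsetI)
      fix j m assume j: "j \<in> {..<n}" and "m \<in> keys (F $ (n - j) * quot i F G j)"
      from this(2) obtain a b where "a \<in> keys (F $ (n - j))" "b \<in> keys (quot i F G j)" "m = a + b"
        by (rule keys_mult_subset)
      moreover have "quot i F G j = K $ j" by (simp add: K_def)
      ultimately show "m \<in> expnn {i} n"
        using less[of j] j supportedD[OF F, of "n - j"] by (force simp: expnn_def lookup_add)
    qed
    moreover have "keys (G $ n) \<subseteq> expnn {i} n" by (rule supportedD[OF G])
    ultimately have hn: "keys (h n) \<subseteq> expnn {i} n"
      unfolding h by (intro order_trans[OF Poly_Mapping.keys_add] Un_least)
    show ?case
    proof
      fix m assume "m \<in> keys (K $ n)"
      then obtain b where b: "b \<in> keys (h n - ct0 {i} (h n))" "m = Poly_Mapping.single i (- 1) + b"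
        unfolding K by (rule keys_single_mult)
      then have "b \<in> keys (h n)" "lookup b i \<noteq> 0"
        by (auto simp: in_keys_iff lookup_minus ct0.rep_eq split: if_splits)
      then show "m \<in> expnn {i} n"
        using hn b(2) by (force simp: expnn_def lookup_add)
    qed
  qed
  have "G0 \<in> supported (expzero {i})"
    by (auto simp: G0_def supported_def keys_ct0 expzero_def)
  moreover have "K \<in> supported (expnn {i})" using keysK by (rule supportedI)
  ultimately show thesis using eq that by blast
qed

lemma L_division:
  assumes "G0 \<in> supported (expzero {i})" "K \<in> supported (expnn {i})" "G = G0 + (tpow i 1 - F) * K"
  shows "L G = G0"
  using assms by (simp add: L_add L_kill L_ident)

text \<open>Modulo multiples of t - F, which \<open>L\<close> kills, \<open>G\<close> equals its
  remainder \<open>G0\<close>. This is free of t, so it passes through \<open>L\<close> as a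
  scalar.\<close>

lemma L_mult:
  assumes G: "G \<in> supported (expnn {i})" and H: "H \<in> supported (expnn {i})"
  shows "L (G * H) = L G * L H"
proof -
  obtain G0 K where g: "G0 \<in> supported (expzero {i})" "K \<in> supported (expnn {i})" "G = G0 + (tpow i 1 - F) * K"
    using division[OF G] .
  have "G * H = G0 * H + (tpow i 1 - F) * (K * H)" unfolding g(3) by (simp add: algebra_simps)
  then have "L (G * H) = G0 * L H"
    using g(1,2) H by (simp add: L_add L_kill L_scale supported_mult)
  then show ?thesis by (simp add: L_division[OF g])
qed

lemma L_tpow: "L (tpow i 1) = L F"
  using L_kill[of 1] by (simp add: L_diff)

text \<open>The chain rule: implicit differentiation of t = F gives the solution the derivative
  \<open>pd j F * geom (pd i F)\<close>. It is proved by differentiating the division identity, and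
  it shows that the image of a class under \<open>L\<close> is again closed under
  \<open>pd j\<close>.\<close>

lemma L_pd:
  assumes G: "G \<in> supported (expnn {i})" and j: "j \<noteq> i"
  shows "pd j (L G) = L (pd j G + pd j F * geom (pd i F) * pd i G)"
proof -
  obtain G0 K where g: "G0 \<in> supported (expzero {i})" "K \<in> supported (expnn {i})" "G = G0 + (tpow i 1 - F) * K"
    using division[OF G] .
  let ?D = "pd j F * geom (pd i F)"
  have D: "?D * (1 - pd i F) = pd j F"
    using geom[OF pd_nth_0[OF F0], of i] by (metis mult.assoc mult.commute mult_1_right)
  have gm: "geom (pd i F) \<in> supported (expnn {i})"
    by (intro supported_geom) (simp_all add: pd_expnn F pd_nth_0 F0)
  have 1: "pd j G = pd j G0 - pd j F * K + (tpow i 1 - F) * pd j K"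
    using j by (simp add: g(3) pd_add pd_mult pd_diff pd_tpow)
  have 2: "pd i G = (1 - pd i F) * K + (tpow i 1 - F) * pd i K"
    by (simp add: g(3) pd_add pd_mult pd_diff pd_tpow pd_eq_0[OF g(1)])
  have "?D * pd i G = ?D * (1 - pd i F) * K + (tpow i 1 - F) * (?D * pd i K)"
    unfolding 2 by (simp add: algebra_simps)
  then have "pd j G + ?D * pd i G = pd j G0 + (tpow i 1 - F) * (pd j K + ?D * pd i K)"
    unfolding 1 D by (simp add: algebra_simps)
  then have "L (pd j G + ?D * pd i G) = pd j G0"
    by (rule L_division[rotated 2]) (use g gm j F in \<open>auto intro!: pd_expzero supported_add supported_mult pd_expnn\<close>)
  then show ?thesis by (simp add: L_division[OF g])
qed

text \<open>Meant for conditions on variables other than \<open>i\<close>, such as nonnegativity in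
  those still to be eliminated; the division by the variable \<open>i\<close> inside
  \<open>L\<close> does not disturb them.\<close>

lemma L_supported:
  assumes "graded M" "F \<in> supported M" "tpow i (- 1) * F \<in> supported M" "pd i F \<in> supported M" "G \<in> supported M"
  shows "L G \<in> supported M"
proof -
  have "geom (tpow i (- 1) * F) \<in> supported M" using assms(1,3) x0 by (rule supported_geom)
  then show ?thesis unfolding L_def using assms by (intro supported_CT supported_mult supported_diff supported_1)
qed

lemma L_geom:
  assumes "G \<in> supported (expnn {i})" "L G $ 0 = 0" "G $ 0 = 0"
  shows "L (geom G) = geom (L G)"
proof (rule geom_unique)
  have "(1 - L G) * L (geom G) = L ((1 - G) * geom G)"
    using assms by (subst L_mult) (auto simp: L_diff L_1 intro!: supported_diff supported_geom)
  then show "(1 - L G) * L (geom G) = 1" using assms by (simp add: geom L_1)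
qed (use assms in simp)

end

section \<open>Eliminating finitely many variables\<close>

text \<open>Substituting the solution for one variable destroys rationality of the other equations. The
  induction therefore ranges over all classes \<open>R\<close> closed under the operations that occur in the
  Jacobian factor, and passes from \<open>R\<close> to its image under the substitution.\<close>

definition closed_class :: "nat set \<Rightarrow> series set \<Rightarrow> bool" where
  "closed_class I R \<longleftrightarrow> R \<subseteq> supported (expnn I) \<and> 1 \<in> R \<and> fps_X \<in> R \<and>
     (\<forall>f\<in>R. \<forall>g\<in>R. f + g \<in> R \<and> f - g \<in> R \<and> f * g \<in> R) \<and>
     (\<forall>i\<in>I. \<forall>f\<in>R. pd i f \<in> R) \<and> (\<forall>f\<in>R. geom (fps_X * f) \<in> R)"

lemma expnn_insert: "supported (expnn (insert i I)) = supported (expnn {i}) \<inter> supported (expnn I)"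
  by (auto simp: supported_def expnn_def subset_iff)
lemma expzero_insert: "supported (expzero (insert i I)) = supported (expzero {i}) \<inter> supported (expzero I)"
  by (auto simp: supported_def expzero_def subset_iff)

lemma pd_fps_X_mult [simp]: "pd i (fps_X * G) = fps_X * pd i G"
  by (simp add: pd_mult pd_eq_0[of _ "{i}"])

text \<open>Good's form of Lagrange inversion in several variables, with \<open>J\<close> in the
  place of the Jacobian determinant. No determinant is written down:
  \<open>elimination_exists\<close> only asserts that some \<open>J\<close> lies in the given class.
  The ring laws are stated for nonnegative exponents, where substitution makes sense.\<close>

definition eliminates :: "nat set \<Rightarrow> (nat \<Rightarrow> series) \<Rightarrow> (series \<Rightarrow> series) \<Rightarrow> series \<Rightarrow> bool" where
  "eliminates I \<phi> \<Lambda> J \<longleftrightarrow>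
     (\<forall>G\<in>supported (expnn I). \<forall>H\<in>supported (expnn I). \<Lambda> (G + H) = \<Lambda> G + \<Lambda> H \<and> \<Lambda> (G * H) = \<Lambda> G * \<Lambda> H) \<and>
     (\<forall>C\<in>supported (expzero I). \<Lambda> C = C) \<and>
     (\<forall>i\<in>I. \<Lambda> (tpow i 1) = \<Lambda> (fps_X * \<phi> i)) \<and>
     (\<forall>G\<in>supported (expnn I). \<Lambda> G = CT I (G * J * (\<Prod>i\<in>I. geom (tpow i (- 1) * (fps_X * \<phi> i)))))"

text \<open>The variable \<open>n\<close> is solved for first, and the other equations are pushed
  through \<open>L\<close> into the image class. Every factor in the constant term given by the
  induction hypothesis is then a value of \<open>L\<close>. Multiplicativity collects them into one
  \<open>L\<close>, and \<open>CT_CT\<close> merges the two constant terms.\<close>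

theorem elimination_exists:
  assumes "finite I" "closed_class I R" "\<And>i. i \<in> I \<Longrightarrow> \<phi> i \<in> R"
  shows "\<exists>\<Lambda>. \<exists>J\<in>R. eliminates I \<phi> \<Lambda> J"
  using assms
proof (induction I arbitrary: R \<phi> rule: finite_induct)
  case empty
  have 1: "1 \<in> R" using empty by (auto simp: closed_class_def)
  have "CT {} G = G" for G by (rule CT_ident) (auto simp: supported_def expzero_def)
  then show ?case
    by (intro exI[of _ "\<lambda>G. G"] bexI[OF _ 1]) (auto simp: eliminates_def)
next
  case (insert n I)
  define F where "F = fps_X * \<phi> n"
  note R_closed = insert.prems(1)[unfolded closed_class_def]
  have "R \<subseteq> supported (expnn {n}) \<inter> supported (expnn I)"
    using R_closed[THEN conjunct1] unfolding expnn_insert[of n I] .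
  then have R: "R \<subseteq> supported (expnn {n})" "R \<subseteq> supported (expnn I)" by simp_all
  have R1: "1 \<in> R" "fps_X \<in> R" using R_closed by simp_all
  have Rpd: "pd i f \<in> R" if "i \<in> insert n I" "f \<in> R" for i f using R_closed that by blast
  have Rg: "geom (fps_X * f) \<in> R" if "f \<in> R" for f using R_closed that by blast
  have Rop: "f + g \<in> R" "f - g \<in> R" "f * g \<in> R" if "f \<in> R" "g \<in> R" for f g
    using R_closed that by blast+
  have \<phi>: "\<phi> n \<in> R" "\<And>i. i \<in> I \<Longrightarrow> \<phi> i \<in> R" using insert.prems(2) by auto
  have Fn: "F \<in> supported (expnn {n})" and FI: "F \<in> supported (expnn I)"
    using R \<phi>(1) by (auto simp: F_def intro!: supported_mult)
  interpret elimination n F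
    by unfold_locales (rule Fn, simp add: F_def)
  have LI: "L G \<in> supported (expnn I)" if "G \<in> supported (expnn I)" for G
    using that FI insert.hyps by (intro L_supported supported_mult pd_expnn) (auto intro: tpow_in_expnn)
  have X: "L (fps_X * G) = fps_X * L G" for G by (rule L_scale) simp
  have geomX: "L (geom (fps_X * G)) = geom (fps_X * L G)" if "G \<in> supported (expnn {n})" for G
    using that by (subst L_geom) (auto simp: X supported_mult)
  define R' where "R' = L ` R"
  define \<phi>' where "\<phi>' i = L (\<phi> i)" for i
  have \<phi>'R: "\<phi>' i \<in> R'" if "i \<in> I" for i using \<phi>(2)[OF that] by (simp add: R'_def \<phi>'_def)
  have "closed_class I R'"
    unfolding closed_class_def
  proof (intro conjI ballI)
    show "R' \<subseteq> supported (expnn I)" using R LI by (auto simp: R'_def)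
    show "1 \<in> R'" using R1 L_1 by (force simp: R'_def)
    have "L fps_X = fps_X" by (rule L_ident) simp
    then show "fps_X \<in> R'" using R1 by (force simp: R'_def)
    fix f assume "f \<in> R'"
    then obtain f' where f: "f' \<in> R" "f = L f'" by (auto simp: R'_def)
    have f'n: "f' \<in> supported (expnn {n})" using f R by auto
    show "geom (fps_X * f) \<in> R'"
      using geomX[OF f'n] Rg f by (auto simp: R'_def image_iff intro!: bexI[of _ "geom (fps_X * f')"])
    { fix i assume i: "i \<in> I"
      \<comment> \<open>As \<open>F\<close> has the factor \<open>fps_X\<close>, so has
        \<open>pd n F\<close>; the geometric series of the chain rule therefore has the form under
        which \<open>R\<close> is closed.\<close>
      have "pd i f' + pd i F * geom (pd n F) * pd n f' \<in> R"
        unfolding F_def pd_fps_X_mult using f(1) \<phi>(1) R1 i by (intro Rop Rpd Rg) auto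
      then show "pd i f \<in> R'"
        using L_pd[OF f'n, of i] i insert.hyps f by (auto simp: R'_def) }
    fix g assume "g \<in> R'"
    then obtain g' where g: "g' \<in> R" "g = L g'" by (auto simp: R'_def)
    have g'n: "g' \<in> supported (expnn {n})" using g R by auto
    show "f + g \<in> R'" "f - g \<in> R'" "f * g \<in> R'"
      unfolding R'_def f(2) g(2) using Rop f(1) g(1)
      by (auto simp: L_add[symmetric] L_diff[symmetric] L_mult[OF f'n g'n, symmetric])
  qed
  then obtain \<Lambda> J' where J': "J' \<in> R'" and elim: "eliminates I \<phi>' \<Lambda> J'"
    using insert.IH[of R' \<phi>'] \<phi>'R by blast
  have hom: "\<Lambda> (G + H) = \<Lambda> G + \<Lambda> H" "\<Lambda> (G * H) = \<Lambda> G * \<Lambda> H"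
    if "G \<in> supported (expnn I)" "H \<in> supported (expnn I)" for G H
    using elim that unfolding eliminates_def by blast+
  have fixed: "\<Lambda> C = C" if "C \<in> supported (expzero I)" for C
    using elim that unfolding eliminates_def by blast
  have tp: "\<Lambda> (tpow i 1) = \<Lambda> (fps_X * \<phi>' i)" if "i \<in> I" for i
    using elim that unfolding eliminates_def by blast
  have ct: "\<Lambda> G = CT I (G * J' * (\<Prod>i\<in>I. geom (tpow i (- 1) * (fps_X * \<phi>' i))))"
    if "G \<in> supported (expnn I)" for G
    using elim that unfolding eliminates_def by blast
  \<comment> \<open>The Jacobian factor of the smaller system is pulled back to \<open>R\<close>;
    times \<open>1 - pd n F\<close> it becomes the new one.\<close>
  obtain j where j: "j \<in> R" "J' = L j" using J' by (auto simp: R'_def)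
  have Xphi: "\<phi> i \<in> supported (expnn {n})" "\<phi> i \<in> supported (expnn I)" if "i \<in> insert n I" for i
    using insert.prems(2)[OF that] R by auto
  have gfac: "geom (tpow i (- 1) * (fps_X * \<phi> i)) \<in> supported (expnn {n})"
      "L (geom (tpow i (- 1) * (fps_X * \<phi> i))) = geom (tpow i (- 1) * (fps_X * \<phi>' i))" if "i \<in> I" for i
  proof -
    \<comment> \<open>The factor has negative exponents in \<open>i\<close> but none in
      \<open>n\<close>, so it is a scalar for \<open>L\<close> and \<open>expnn {n}\<close> is the
      right condition here.\<close>
    have tz: "tpow i (- 1) \<in> supported (expzero {n})" using that insert.hyps by (intro tpow_in_expzero) auto
    have eq: "tpow i (- 1) * (fps_X * \<phi> i) = fps_X * (tpow i (- 1) * \<phi> i)" by (simp only: mult_ac)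
    have in_sub: "tpow i (- 1) * \<phi> i \<in> supported (expnn {n})"
      using supported_expzero_expnn[OF tz] that Xphi by (intro supported_mult) auto
    show "geom (tpow i (- 1) * (fps_X * \<phi> i)) \<in> supported (expnn {n})"
      unfolding eq by (rule supported_geom) (simp_all add: in_sub supported_mult[of _ fps_X])
    show "L (geom (tpow i (- 1) * (fps_X * \<phi> i))) = geom (tpow i (- 1) * (fps_X * \<phi>' i))"
      unfolding eq geomX[OF in_sub] L_scale[OF tz] \<phi>'_def by (simp only: mult_ac)
  qed
  let ?P = "\<Prod>i\<in>I. geom (tpow i (- 1) * (fps_X * \<phi> i))"
  have P: "?P \<in> supported (expnn {n})" "L ?P = (\<Prod>i\<in>I. geom (tpow i (- 1) * (fps_X * \<phi>' i)))"
  proof -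
    have "(\<Prod>i\<in>I'. geom (tpow i (- 1) * (fps_X * \<phi> i))) \<in> supported (expnn {n}) \<and>
      L (\<Prod>i\<in>I'. geom (tpow i (- 1) * (fps_X * \<phi> i))) = (\<Prod>i\<in>I'. geom (tpow i (- 1) * (fps_X * \<phi>' i)))"
      if "finite I'" "I' \<subseteq> I" for I'
      using that
    proof (induction I' rule: finite_induct)
      case (insert m I')
      then show ?case using gfac[of m] by (auto simp: L_mult intro!: supported_mult)
    qed (simp add: L_1)
    then show "?P \<in> supported (expnn {n})" "L ?P = (\<Prod>i\<in>I. geom (tpow i (- 1) * (fps_X * \<phi>' i)))"
      using insert.hyps(1) by auto
  qed
  have formula: "\<Lambda> (L G) = CT (insert n I) (G * (j * (1 - pd n F)) * (\<Prod>i\<in>insert n I. geom (tpow i (- 1) * (fps_X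
      * \<phi> i))))"
    if G: "G \<in> supported (expnn (insert n I))" for G
  proof -
    have G': "G \<in> supported (expnn {n})" "G \<in> supported (expnn I)" using G unfolding expnn_insert[of n I] by auto
    have jn: "j \<in> supported (expnn {n})" using j R by auto
    have "\<Lambda> (L G) = CT I (L G * L j * L ?P)"
      using ct[OF LI[OF G'(2)]] by (simp only: j P)
    also have "L G * L j * L ?P = L (G * j * ?P)"
      using G' jn P(1) by (simp add: L_mult supported_mult)
    also have "CT I (L (G * j * ?P)) = CT (insert n I) (G * j * ?P * ((1 - pd n F) * geom (tpow n (- 1) * F)))"
      unfolding L_def CT_CT by simp
    also have "G * j * ?P * ((1 - pd n F) * geom (tpow n (- 1) * F)) =
      G * (j * (1 - pd n F)) * (\<Prod>i\<in>insert n I. geom (tpow i (- 1) * (fps_X * \<phi> i)))"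
      unfolding prod.insert[OF insert.hyps] F_def by (simp only: mult_ac)
    finally show ?thesis .
  qed
  show ?case
    unfolding eliminates_def
  proof (intro exI[of _ "\<lambda>G. \<Lambda> (L G)"] bexI[of _ "j * (1 - pd n F)"] conjI ballI)
    show "j * (1 - pd n F) \<in> R"
      unfolding F_def pd_fps_X_mult using j(1) \<phi>(1) R1 by (intro Rop Rpd) auto
    fix G H assume G: "G \<in> supported (expnn (insert n I))" and H: "H \<in> supported (expnn (insert n I))"
    then have G': "G \<in> supported (expnn {n})" "G \<in> supported (expnn I)" "H \<in> supported (expnn {n})"
        "H \<in> supported (expnn I)"
      unfolding expnn_insert[of n I] by auto
    show "\<Lambda> (L (G + H)) = \<Lambda> (L G) + \<Lambda> (L H)" "\<Lambda> (L (G * H)) = \<Lambda> (L G) * \<Lambda> (L H)"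
      using G' by (simp_all add: L_add L_mult hom LI)
  next
    fix C assume "C \<in> supported (expzero (insert n I))"
    then show "\<Lambda> (L C) = C" unfolding expzero_insert[of n I] by (simp add: L_ident fixed)
  next
    fix i assume i: "i \<in> insert n I"
    show "\<Lambda> (L (tpow i 1)) = \<Lambda> (L (fps_X * \<phi> i))"
    proof (cases "i = n")
      case True
      then show ?thesis using L_tpow by (simp add: F_def)
    next
      case False
      then have "L (tpow i 1) = tpow i 1" by (intro L_ident tpow_in_expzero) auto
      then show ?thesis using False i tp[of i] by (simp add: X \<phi>'_def)
    qed
  qed (rule formula)
qed

section \<open>Rational series with bounded exponents\<close>

text \<open>The slope 1 in the bound comes from the geometric series of the elimination formula,
  where each \<open>tpow i (- 1)\<close> is accompanied by one \<open>fps_X\<close>.\<close>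

definition expbound :: "nat \<Rightarrow> nat set \<Rightarrow> nat \<Rightarrow> lmon set" where
  "expbound s J k = {m. keys m \<subseteq> {..<s} \<and> (\<forall>i. lookup m i \<ge> (if i \<in> J then - int k else 0))}"

lemma graded_expbound [simp]: "graded (expbound s J)"
  unfolding graded_def
proof (intro conjI allI ballI)
  show "0 \<in> expbound s J 0" by (simp add: expbound_def)
  fix j k a b assume a: "a \<in> expbound s J j" and b: "b \<in> expbound s J k"
  have "keys (a + b) \<subseteq> {..<s}"
    using a b by (intro order_trans[OF Poly_Mapping.keys_add]) (auto simp: expbound_def)
  moreover have "lookup (a + b) i \<ge> (if i \<in> J then - int (j + k) else 0)" for i
  proof -
    have "lookup a i \<ge> (if i \<in> J then - int j else 0)" "lookup b i \<ge> (if i \<in> J then - int k else 0)"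
      using a b by (simp_all add: expbound_def)
    then show ?thesis by (auto simp: lookup_add split: if_splits)
  qed
  ultimately show "a + b \<in> expbound s J (j + k)" by (simp add: expbound_def)
qed

definition zpoly :: "series set" where
  "zpoly = {f. \<exists>d. \<forall>k>d. f $ k = 0}"

lemma zpoly_0 [simp]: "0 \<in> zpoly" by (auto simp: zpoly_def)
lemma zpoly_1 [simp]: "1 \<in> zpoly" by (auto simp: zpoly_def)
lemma zpoly_X [simp]: "fps_X \<in> zpoly" by (auto simp: zpoly_def fps_X_def)
lemma zpoly_const [simp]: "fps_const c \<in> zpoly" by (auto simp: zpoly_def)
lemma zpoly_tpow [simp]: "tpow i e \<in> zpoly" by (simp add: tpow_def)

lemma zpoly_add: "f \<in> zpoly \<Longrightarrow> g \<in> zpoly \<Longrightarrow> f + g \<in> zpoly"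
proof -
  assume "f \<in> zpoly" "g \<in> zpoly"
  then obtain d e where "\<forall>k>d. f $ k = 0" "\<forall>k>e. g $ k = 0" by (auto simp: zpoly_def)
  then have "\<forall>k>max d e. (f + g) $ k = 0" by simp
  then show ?thesis unfolding zpoly_def by blast
qed

lemma zpoly_mult: "f \<in> zpoly \<Longrightarrow> g \<in> zpoly \<Longrightarrow> f * g \<in> zpoly"
proof -
  assume "f \<in> zpoly" "g \<in> zpoly"
  then obtain d e where de: "\<forall>k>d. f $ k = 0" "\<forall>k>e. g $ k = 0" by (auto simp: zpoly_def)
  have "(f * g) $ k = 0" if "k > d + e" for k
    unfolding fps_mult_nth
  proof (rule sum.neutral, rule ballI)
    fix i assume "i \<in> {0..k}"
    then have "i > d \<or> k - i > e" using that by auto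
    then show "f $ i * g $ (k - i) = 0" using de by auto
  qed
  then show ?thesis unfolding zpoly_def by blast
qed

lemma zpoly_uminus: "f \<in> zpoly \<Longrightarrow> - f \<in> zpoly" by (auto simp: zpoly_def)
lemma zpoly_diff: "f \<in> zpoly \<Longrightarrow> g \<in> zpoly \<Longrightarrow> f - g \<in> zpoly"
  using zpoly_add[of f "- g"] by (simp add: zpoly_uminus)
lemma zpoly_sum: "(\<And>i. i \<in> I \<Longrightarrow> f i \<in> zpoly) \<Longrightarrow> sum f I \<in> zpoly"
  by (induction I rule: infinite_finite_induct) (simp_all add: zpoly_add zpoly_0)
lemma zpoly_pd: "f \<in> zpoly \<Longrightarrow> pd i f \<in> zpoly"
proof -
  assume "f \<in> zpoly"
  then obtain d where "\<forall>k>d. f $ k = 0" by (auto simp: zpoly_def)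
  then have "\<forall>k>d. theta i f $ k = 0" by simp
  then have "theta i f \<in> zpoly" unfolding zpoly_def by blast
  then show ?thesis unfolding pd_def by (intro zpoly_mult zpoly_tpow)
qed

section \<open>Polynomials and fractions with normalised denominator\<close>

definition polys :: "nat \<Rightarrow> nat set \<Rightarrow> series set" where
  "polys s J = zpoly \<inter> supported (expbound s J)"

text \<open>\<open>D $ 0 = 1\<close> makes \<open>D\<close> a unit, so the fraction is
  \<open>P * geom (1 - D)\<close> and inherits the exponent bound. The normalisation also survives
  the formation of \<open>geom\<close>.\<close>

definition fracs :: "nat \<Rightarrow> nat set \<Rightarrow> series set" where
  "fracs s J = {f. \<exists>P\<in>polys s J. \<exists>D\<in>polys s J. D $ 0 = 1 \<and> D * f = P}"

lemma fracsI: "P \<in> polys s J \<Longrightarrow> D \<in> polys s J \<Longrightarrow> D $ 0 = 1 \<Longrightarrow> D * f = P \<Longrightarrow> f \<in> fracs s J"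
  by (auto simp: fracs_def)

lemma fracsE:
  assumes "f \<in> fracs s J"
  obtains P D where "P \<in> polys s J" "D \<in> polys s J" "D $ 0 = 1" "D * f = P"
  using assms by (auto simp: fracs_def)

lemma polys_1 [simp]: "1 \<in> polys s J" by (simp add: polys_def supported_1)
lemma polys_X [simp]: "fps_X \<in> polys s J"
  by (auto simp: polys_def expbound_def intro: fps_X_in_supported)
lemma polys_add: "f \<in> polys s J \<Longrightarrow> g \<in> polys s J \<Longrightarrow> f + g \<in> polys s J"
  by (simp add: polys_def zpoly_add supported_add)
lemma polys_diff: "f \<in> polys s J \<Longrightarrow> g \<in> polys s J \<Longrightarrow> f - g \<in> polys s J"
  by (simp add: polys_def zpoly_diff supported_diff)
lemma polys_mult: "f \<in> polys s J \<Longrightarrow> g \<in> polys s J \<Longrightarrow> f * g \<in> polys s J"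
  by (simp add: polys_def zpoly_mult supported_mult)
lemma polys_sum: "(\<And>i. i \<in> I \<Longrightarrow> f i \<in> polys s J) \<Longrightarrow> sum f I \<in> polys s J"
  by (simp add: polys_def zpoly_sum supported_sum)
lemma polys_tpow: "i < s \<Longrightarrow> e \<ge> 0 \<Longrightarrow> tpow i e \<in> polys s J"
  by (auto simp: polys_def supported_def keys_tpow expbound_def lookup_single when_def)
lemma polys_0 [simp]: "0 \<in> polys s J"
  by (auto simp: polys_def zpoly_def)
lemma polys_mono: "polys s {} \<subseteq> polys s J"
proof -
  have "expbound s {} k \<subseteq> expbound s J k" for k
  proof
    fix m assume "m \<in> expbound s {} k"
    then have m: "keys m \<subseteq> {..<s}" "\<And>i. 0 \<le> lookup m i" by (auto simp: expbound_def)
    have "(if i \<in> J then - int k else 0) \<le> lookup m i" for i using m(2)[of i] by simp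
    then show "m \<in> expbound s J k" using m(1) unfolding expbound_def by blast
  qed
  then show ?thesis using supported_mono[of "expbound s {}" "expbound s J"] by (auto simp: polys_def)
qed

lemma polys_pd:
  assumes "f \<in> polys s {}"
  shows "pd i f \<in> polys s {}"
proof -
  have f: "f \<in> zpoly" "f \<in> supported (expbound s {})" using assms by (auto simp: polys_def)
  have "pd i f \<in> supported (expbound s {})"
  proof (rule supportedI, rule subsetI)
    fix k m assume "m \<in> keys (pd i f $ k)"
    then obtain n where n: "n \<in> keys (f $ k)" "lookup n i \<noteq> 0" "m = Poly_Mapping.single i (- 1) + n"
      by (rule keys_pd)
    have nb: "keys n \<subseteq> {..<s}" "\<And>j. lookup n j \<ge> 0"
      using supportedD[OF f(2), of k] n(1) by (auto simp: expbound_def)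
    then have "i < s" using n(2) by (auto simp: in_keys_iff subset_iff)
    then have "keys m \<subseteq> {..<s}"
      unfolding n(3) using nb(1) by (intro order_trans[OF Poly_Mapping.keys_add]) auto
    moreover have "lookup m j \<ge> 0" for j
      using n(2) nb(2)[of j] by (auto simp: n(3) lookup_add lookup_single when_def)
    ultimately show "m \<in> expbound s {} k" by (simp add: expbound_def)
  qed
  then show ?thesis using f(1) by (simp add: polys_def zpoly_pd)
qed

lemma fracs_eq_geom: "D $ 0 = 1 \<Longrightarrow> D * f = P \<Longrightarrow> f = P * geom (1 - D)"
proof -
  assume D: "D $ 0 = 1" "D * f = P"
  have "D * geom (1 - D) = 1" using geom[of "1 - D"] D(1) by simp
  then have "f = (D * geom (1 - D)) * f" by simp
  also have "\<dots> = P * geom (1 - D)" unfolding D(2)[symmetric] by (simp only: mult_ac)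
  finally show ?thesis .
qed

lemma fracs_supported: "f \<in> fracs s J \<Longrightarrow> f \<in> supported (expbound s J)"
proof (elim fracsE)
  fix P D assume *: "P \<in> polys s J" "D \<in> polys s J" "D $ 0 = 1" "D * f = P"
  have "geom (1 - D) \<in> supported (expbound s J)"
    using * by (intro supported_geom supported_diff) (auto simp: polys_def supported_1)
  then show ?thesis
    using * by (subst fracs_eq_geom[OF *(3,4)]) (auto simp: polys_def intro: supported_mult)
qed

lemma polys_fracs: "f \<in> polys s J \<Longrightarrow> f \<in> fracs s J"
  by (rule fracsI[of f _ _ 1]) auto

lemma fracs_add: "f \<in> fracs s J \<Longrightarrow> g \<in> fracs s J \<Longrightarrow> f + g \<in> fracs s J"
proof (elim fracsE)
  fix P D P' D'
  assume *: "P \<in> polys s J" "D \<in> polys s J" "D $ 0 = 1" "D * f = P"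
    "P' \<in> polys s J" "D' \<in> polys s J" "D' $ 0 = 1" "D' * g = P'"
  show ?thesis
    by (rule fracsI[of "D' * P + D * P'" _ _ "D * D'"])
      (use * in \<open>auto intro!: polys_add polys_mult simp: algebra_simps\<close>)
qed

lemma fracs_mult: "f \<in> fracs s J \<Longrightarrow> g \<in> fracs s J \<Longrightarrow> f * g \<in> fracs s J"
proof (elim fracsE)
  fix P D P' D'
  assume *: "P \<in> polys s J" "D \<in> polys s J" "D $ 0 = 1" "D * f = P"
    "P' \<in> polys s J" "D' \<in> polys s J" "D' $ 0 = 1" "D' * g = P'"
  show ?thesis
    by (rule fracsI[of "P * P'" _ _ "D * D'"])
      (use * in \<open>auto intro!: polys_mult simp: mult_ac\<close>)
qed

lemma fracs_prod: "(\<And>i. i \<in> I \<Longrightarrow> f i \<in> fracs s J) \<Longrightarrow> prod f I \<in> fracs s J"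
  by (induction I rule: infinite_finite_induct) (auto intro: fracs_mult polys_fracs)

lemma fracs_geom: "f \<in> fracs s J \<Longrightarrow> f $ 0 = 0 \<Longrightarrow> geom f \<in> fracs s J"
proof (elim fracsE)
  fix P D assume *: "P \<in> polys s J" "D \<in> polys s J" "D $ 0 = 1" "D * f = P" and f: "f $ 0 = 0"
  have "(D - P) * geom f = D * ((1 - f) * geom f)"
    unfolding *(4)[symmetric] by (simp add: algebra_simps)
  then have "(D - P) * geom f = D" by (simp only: geom[OF f] mult_1_right)
  moreover have "P $ 0 = 0" using * f by auto
  ultimately show ?thesis using * by (intro fracsI[of D _ _ "D - P"]) (auto intro: polys_diff)
qed

lemma fracs_pd: "f \<in> fracs s {} \<Longrightarrow> pd i f \<in> fracs s {}"
proof (elim fracsE)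
  fix P D assume *: "P \<in> polys s {}" "D \<in> polys s {}" "D $ 0 = 1" "D * f = P"
  have "pd i P = pd i D * f + D * pd i f" unfolding *(4)[symmetric] by (rule pd_mult)
  then have "D * D * pd i f = D * pd i P - pd i D * P"
    unfolding *(4)[symmetric] by (simp add: algebra_simps)
  then show ?thesis using *
    by (intro fracsI[of "D * pd i P - pd i D * P" _ _ "D * D"]) (auto intro!: polys_diff polys_mult polys_pd)
qed

lemma fracs_mono: "f \<in> fracs s {} \<Longrightarrow> f \<in> fracs s J"
  using polys_mono unfolding fracs_def by blast

lemma closed_class_fracs: "closed_class I (fracs s {})"
  unfolding closed_class_def
proof (intro conjI ballI)
  show "fracs s {} \<subseteq> supported (expnn I)"
    using supported_mono[of "expbound s {}" "expnn I"] fracs_supported by (force simp: expbound_def expnn_def)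
  show "1 \<in> fracs s {}" "fps_X \<in> fracs s {}" by (simp_all add: polys_fracs)
  fix f assume f: "f \<in> fracs s {}"
  show "geom (fps_X * f) \<in> fracs s {}"
    using f by (intro fracs_geom fracs_mult) (auto simp: polys_fracs)
  show "pd i f \<in> fracs s {}" for i using f by (rule fracs_pd)
  fix g assume g: "g \<in> fracs s {}"
  show "f + g \<in> fracs s {}" "f * g \<in> fracs s {}" using f g by (simp_all add: fracs_add fracs_mult)
  have "- 1 \<in> polys s {}" using polys_diff[of 0 s "{}" 1] by simp
  then have "f + (- 1) * g \<in> fracs s {}" using f g by (intro fracs_add fracs_mult) (auto simp: polys_fracs)
  then show "f - g \<in> fracs s {}" by simp
qed

section \<open>From Laurent constant terms to diagonals\<close>

text \<open>Replacing \<open>z\<close>, which becomes \<open>x\<^sub>s\<close>, by its product with all \<open>x\<^sub>i\<close> for \<open>i \<in> J\<close> turns exponents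
  at least \<open>-k\<close> at \<open>z\<^sup>k\<close> into nonnegative ones.\<close>

definition shift :: "nat \<Rightarrow> nat set \<Rightarrow> monomial \<Rightarrow> lmon" where
  "shift s J m = Abs_poly_mapping (\<lambda>i. if i < s then int (lookup m i) - (if i \<in> J then int (lookup m s) else 0)
      else 0)"

definition unshift :: "nat \<Rightarrow> nat set \<Rightarrow> nat \<Rightarrow> lmon \<Rightarrow> monomial" where
  "unshift s J k n = Abs_poly_mapping (\<lambda>i. if i < s then nat (lookup n i + (if i \<in> J then int k else 0))
     else if i = s then k else 0)"

text \<open>The coefficients after the change of variables, with the exponent of z read off at
  \<open>x_s\<close>. The test on \<open>keys m\<close> is necessary because \<open>shift\<close>
  forgets all variables beyond \<open>x_s\<close>.\<close>

definition emb :: "nat \<Rightarrow> nat set \<Rightarrow> series \<Rightarrow> monomial \<Rightarrow> int" where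
  "emb s J f m = (if keys m \<subseteq> {..<Suc s} then lookup (f $ lookup m s) (shift s J m) else 0)"

lemma lookup_shift: "lookup (shift s J m) i = (if i < s then int (lookup m i) - (if i \<in> J then int (lookup m s)
    else 0) else 0)"
  unfolding shift_def by (subst lookup_Abs_poly_mapping) (auto intro: finite_subset[of _ "{..<s}"])

lemma lookup_unshift: "lookup (unshift s J k n) i = (if i < s then nat (lookup n i + (if i \<in> J then int k else 0))
     else if i = s then k else 0)"
  unfolding unshift_def by (subst lookup_Abs_poly_mapping) (auto intro: finite_subset[of _ "{..s}"] split: if_splits)

lemma shift_unshift: "n \<in> expbound s J k \<Longrightarrow> shift s J (unshift s J k n) = n"
proof (rule poly_mapping_eqI)
  fix i assume n: "n \<in> expbound s J k"
  then have "lookup n i \<ge> (if i \<in> J then - int k else 0)" "i \<ge> s \<Longrightarrow> lookup n i = 0"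
    by (auto simp: expbound_def in_keys_iff subset_iff not_less[symmetric])
  then show "lookup (shift s J (unshift s J k n)) i = lookup n i"
    by (auto simp: lookup_shift lookup_unshift split: if_splits)
qed

lemma unshift_shift: "keys m \<subseteq> {..<Suc s} \<Longrightarrow> unshift s J (lookup m s) (shift s J m) = m"
proof (rule poly_mapping_eqI)
  fix i assume "keys m \<subseteq> {..<Suc s}"
  then have "i > s \<Longrightarrow> lookup m i = 0" by (metis in_keys_iff lessThan_iff not_less_eq subsetD)
  then show "lookup (unshift s J (lookup m s) (shift s J m)) i = lookup m i"
    by (auto simp: lookup_shift lookup_unshift)
qed

lemma shift_add: "shift s J (m + n) = shift s J m + shift s J n"
  by (rule poly_mapping_eqI) (simp add: lookup_shift lookup_add)

lemma unshift_add:
  assumes "a \<in> expbound s J j" "b \<in> expbound s J k"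
  shows "unshift s J j a + unshift s J k b = unshift s J (j + k) (a + b)"
proof (rule poly_mapping_eqI)
  fix i
  have "lookup a i \<ge> (if i \<in> J then - int j else 0)" "lookup b i \<ge> (if i \<in> J then - int k else 0)"
    using assms by (simp_all add: expbound_def)
  then show "lookup (unshift s J j a + unshift s J k b) i = lookup (unshift s J (j + k) (a + b)) i"
    by (auto simp: lookup_add lookup_unshift nat_add_distrib[symmetric] split: if_splits)
qed

lemma emb_neq_0: "emb s J f m \<noteq> 0 \<Longrightarrow> shift s J m \<in> keys (f $ lookup m s)"
  by (simp add: emb_def in_keys_iff split: if_splits)

lemma keys_add_nat: "keys (m + n :: monomial) = keys m \<union> keys n"
  by (auto simp: in_keys_iff lookup_add)

text \<open>Splittings of \<open>m\<close> into monomials with nonzero coefficients correspond to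
  splittings of the z-exponent together with the Laurent exponent. The bound on exponents makes
  \<open>unshift\<close> an inverse, as its \<open>nat\<close> would otherwise truncate.\<close>

lemma emb_mult:
  assumes f: "f \<in> supported (expbound s J)" and g: "g \<in> supported (expbound s J)"
  shows "mps_mult (emb s J f) (emb s J g) m = emb s J (f * g) m"
proof (cases "keys m \<subseteq> {..<Suc s}")
  case False
  have "emb s J f i * emb s J g j = 0" if "i + j = m" for i j
    using False that by (auto simp: emb_def keys_add_nat)
  then have "mps_mult (emb s J f) (emb s J g) m = 0"
    unfolding mps_mult_def by (intro sum.neutral) auto
  then show ?thesis using False by (simp add: emb_def)
next
  case True
  define k where "k = lookup m s"
  define T where "T = (SIGMA a:{0..k}. {(b, c) \<in> keys (f $ a) \<times> keys (g $ (k - a)). b + c = shift s J m})"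
  define S where "S = {(i, j). i + j = m \<and> shift s J i \<in> keys (f $ lookup i s) \<and> shift s J j \<in> keys (g $ lookup j s)}"
  have "mps_mult (emb s J f) (emb s J g) m = (\<Sum>(i, j)\<in>S. emb s J f i * emb s J g j)"
    unfolding mps_mult_def
    by (rule sum.mono_neutral_right) (auto simp: finite_monomial_splits S_def dest!: emb_neq_0)
  also have "\<dots> = (\<Sum>(a, b, c)\<in>T. lookup (f $ a) b * lookup (g $ (k - a)) c)"
  proof (rule sum.reindex_bij_witness[where
        i = "\<lambda>(a, b, c). (unshift s J a b, unshift s J (k - a) c)" and
        j = "\<lambda>(i, j). (lookup i s, shift s J i, shift s J j)"])
    fix z assume "z \<in> S"
    then obtain i j where z: "z = (i, j)" "i + j = m" "shift s J i \<in> keys (f $ lookup i s)"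
      "shift s J j \<in> keys (g $ lookup j s)" by (auto simp: S_def)
    have k: "k = lookup i s + lookup j s" using z by (auto simp: k_def lookup_add)
    have ij: "keys i \<subseteq> {..<Suc s}" "keys j \<subseteq> {..<Suc s}" using True z by (auto simp: keys_add_nat)
    show "(\<lambda>(a, b, c). (unshift s J a b, unshift s J (k - a) c)) ((\<lambda>(i, j). (lookup i s, shift s J i,
        shift s J j)) z) = z"
      using ij by (simp add: z k unshift_shift)
    show "(\<lambda>(i, j). (lookup i s, shift s J i, shift s J j)) z \<in> T"
      using z k by (auto simp: T_def shift_add)
    show "(case (\<lambda>(i, j). (lookup i s, shift s J i, shift s J j)) z of
        (a, b, c) \<Rightarrow> lookup (f $ a) b * lookup (g $ (k - a)) c) =
        (case z of (i, j) \<Rightarrow> emb s J f i * emb s J g j)"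
      using ij by (simp add: z k emb_def)
  next
    fix y assume "y \<in> T"
    then obtain a b c where y: "y = (a, b, c)" "a \<le> k" "b \<in> keys (f $ a)" "c \<in> keys (g $ (k - a))"
      "b + c = shift s J m" by (auto simp: T_def)
    have b: "b \<in> expbound s J a" using supportedD[OF f] y by blast
    have c: "c \<in> expbound s J (k - a)" using supportedD[OF g] y by blast
    have "unshift s J a b + unshift s J (k - a) c = unshift s J k (shift s J m)"
      using unshift_add[OF b c] y by simp
    then have "unshift s J a b + unshift s J (k - a) c = m"
      using unshift_shift[OF True] by (simp add: k_def)
    then show "(\<lambda>(a, b, c). (unshift s J a b, unshift s J (k - a) c)) y \<in> S"
      using y by (auto simp: S_def shift_unshift[OF b] shift_unshift[OF c] lookup_unshift)
    show "(\<lambda>(i, j). (lookup i s, shift s J i, shift s J j)) ((\<lambda>(a, b, c). (unshift s J a b,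
        unshift s J (k - a) c)) y) = y"
      using y by (simp add: shift_unshift[OF b] shift_unshift[OF c] lookup_unshift)
  qed
  also have "\<dots> = (\<Sum>a=0..k. \<Sum>(b, c)\<in>{(b, c) \<in> keys (f $ a) \<times> keys (g $ (k - a)). b + c = shift s J m}.
      lookup (f $ a) b * lookup (g $ (k - a)) c)"
  proof -
    have "finite {(b, c) \<in> keys (f $ a) \<times> keys (g $ (k - a)). b + c = shift s J m}" for a
      by (rule finite_subset[of _ "keys (f $ a) \<times> keys (g $ (k - a))"]) auto
    then show ?thesis unfolding T_def by (simp add: sum.Sigma)
  qed
  also have "\<dots> = (\<Sum>a=0..k. lookup (f $ a * g $ (k - a)) (shift s J m))"
  proof (rule sum.cong[OF HOL.refl])
    fix a
    let ?A = "keys (f $ a)" and ?B = "keys (g $ (k - a))"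
    have "(\<Sum>(b, c)\<in>{(b, c) \<in> ?A \<times> ?B. b + c = shift s J m}. lookup (f $ a) b * lookup (g $ (k - a)) c)
      = (\<Sum>(b, c)\<in>?A \<times> ?B. if b + c = shift s J m then lookup (f $ a) b * lookup (g $ (k - a)) c else 0)"
      by (rule sum.mono_neutral_cong_left) (auto split: if_splits)
    also have "\<dots> = lookup (f $ a * g $ (k - a)) (shift s J m)"
      by (subst lookup_mult_finite[OF finite_keys subset_refl finite_keys subset_refl])
        (simp add: sum.cartesian_product)
    finally show "(\<Sum>(b, c)\<in>{(b, c) \<in> ?A \<times> ?B. b + c = shift s J m}. lookup (f $ a) b * lookup (g $ (k - a)) c)
      = lookup (f $ a * g $ (k - a)) (shift s J m)" .
  qed
  also have "\<dots> = emb s J (f * g) m"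
    using True by (simp add: emb_def k_def fps_mult_nth lookup_sum)
  finally show ?thesis .
qed

lemma finite_emb_support:
  assumes "f \<in> zpoly"
  shows "finite {m. emb s J f m \<noteq> 0}"
proof -
  obtain d where d: "\<And>k. k > d \<Longrightarrow> f $ k = 0" using assms by (auto simp: zpoly_def)
  have "{m. emb s J f m \<noteq> 0} \<subseteq> (\<lambda>(k, n). unshift s J k n) ` (SIGMA k:{..d}. keys (f $ k))"
  proof
    fix m assume m: "m \<in> {m. emb s J f m \<noteq> 0}"
    then have *: "keys m \<subseteq> {..<Suc s}" "shift s J m \<in> keys (f $ lookup m s)"
      by (auto simp: emb_def in_keys_iff split: if_splits)
    then have "lookup m s \<le> d" using d[of "lookup m s"] by (cases "lookup m s \<le> d") auto
    then show "m \<in> (\<lambda>(k, n). unshift s J k n) ` (SIGMA k:{..d}. keys (f $ k))"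
      using * unshift_shift[OF *(1), of J] by (intro image_eqI[of _ _ "(lookup m s, shift s J m)"]) auto
  qed
  then show ?thesis by (rule finite_subset) auto
qed

text \<open>On the diagonal all exponents are k, so the Laurent exponent is k - k = 0 for variables
  in \<open>J\<close> and k for the others: a constant term in the former and a coefficient
  extraction in the latter.\<close>

theorem fracs_diagonal:
  assumes Q: "Q \<in> fracs s J"
  shows "\<exists>r. rational_mps (Suc s) r \<and>
    diagonal (Suc s) r = Abs_fps (\<lambda>k. of_int (lookup (Q $ k) (\<Sum>i\<in>{..<s} - J. Poly_Mapping.single i (int k))))"
proof -
  obtain P D where PD: "P \<in> polys s J" "D \<in> polys s J" "D $ 0 = 1" "D * Q = P"
    using Q by (rule fracsE)
  define r :: "monomial \<Rightarrow> rat" where "r m = of_int (emb s J Q m)" for m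
  define p where "p f = (Abs_poly_mapping (emb s J f) :: monomial \<Rightarrow>\<^sub>0 int)" for f
  have p: "lookup (p f) = emb s J f" if "f \<in> polys s J" for f
    unfolding p_def using finite_emb_support[of f s J] that by (simp add: polys_def)
  have "mps_mult (mps_of_poly (p D)) r m = of_int (mps_mult (emb s J D) (emb s J Q) m)" for m
    by (simp add: mps_mult_def mps_of_poly_def r_def p[OF PD(2)] case_prod_beta)
  also have "\<dots> m = of_int (emb s J P m)" for m
    using emb_mult[of D s J Q m] PD fracs_supported[OF Q] by (simp add: polys_def)
  finally have eq: "mps_mult (mps_of_poly (p D)) r = mps_of_poly (p P)"
    by (simp add: fun_eq_iff mps_of_poly_def p[OF PD(1)])
  have "shift s J 0 = 0" by (rule poly_mapping_eqI) (simp add: lookup_shift)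
  then have "emb s J D 0 = 1" using PD(3) by (simp add: emb_def)
  then have "p D \<noteq> 0" using p[OF PD(2)] by (metis lookup_zero zero_neq_one)
  moreover have "is_mps (Suc s) (emb s J f)" for f by (auto simp: is_mps_def emb_def split: if_splits)
  then have "is_mps (Suc s) r" "is_mps (Suc s) (lookup (p P))" "is_mps (Suc s) (lookup (p D))"
    by (simp_all add: p PD) (simp add: is_mps_def r_def)
  ultimately have "rational_mps (Suc s) r"
    unfolding rational_mps_def using eq by blast
  moreover have "diagonal (Suc s) r = Abs_fps (\<lambda>k. of_int (lookup (Q $ k) (\<Sum>i\<in>{..<s} - J. Poly_Mapping.single i
      (int k))))"
  proof (rule fps_ext)
    fix k
    let ?m = "\<Sum>i<Suc s. Poly_Mapping.single i k :: monomial"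
    have l: "lookup ?m i = (if i < Suc s then k else 0)" for i
      unfolding lookup_sum lookup_single when_def by simp
    have sh: "shift s J ?m = (\<Sum>i\<in>{..<s} - J. Poly_Mapping.single i (int k))"
    proof (rule poly_mapping_eqI)
      fix i
      have "lookup (\<Sum>i\<in>{..<s} - J. Poly_Mapping.single i (int k)) i = (if i \<in> {..<s} - J then int k else 0)"
        unfolding lookup_sum lookup_single when_def by (simp add: sum.delta)
      then show "lookup (shift s J ?m) i = lookup (\<Sum>i\<in>{..<s} - J. Poly_Mapping.single i (int k)) i"
        unfolding lookup_shift l by simp
    qed
    have "keys ?m \<subseteq> {..<Suc s}"
      unfolding subset_iff in_keys_iff l by simp
    then have "r ?m = of_int (lookup (Q $ k) (\<Sum>i\<in>{..<s} - J. Poly_Mapping.single i (int k)))"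
      unfolding r_def emb_def sh l by simp
    then show "diagonal (Suc s) r $ k = Abs_fps (\<lambda>k. of_int (lookup (Q $ k) (\<Sum>i\<in>{..<s} - J. Poly_Mapping.single
        i (int k)))) $ k"
      by (simp add: diagonal_def)
  qed
  ultimately show ?thesis by blast
qed

section \<open>Counting runs of a pushdown machine\<close>

datatype ('p, 'g) action = Stay 'p | Push 'p 'g | Pop "'g \<Rightarrow> 'p"

text \<open>Polymorphic in the result so that one definition drives partial runs, their weights and
  their generating series; \<open>z\<close> is the value when the empty stack is popped.\<close>

definition proceed :: "('p \<Rightarrow> 'g list \<Rightarrow> 'r) \<Rightarrow> 'r \<Rightarrow> 'g list \<Rightarrow> ('p, 'g) action \<Rightarrow> 'r" where
  "proceed h z st a = (case a of Stay p \<Rightarrow> h p st | Push p g \<Rightarrow> h p (g # st)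
     | Pop f \<Rightarrow> (case st of [] \<Rightarrow> z | g # st' \<Rightarrow> h (f g) st'))"

definition on_pop :: "(('g \<Rightarrow> 'p) \<Rightarrow> 'r) \<Rightarrow> ('p, 'g) action \<Rightarrow> 'r::zero" where
  "on_pop h a = (case a of Pop f \<Rightarrow> h f | _ \<Rightarrow> 0)"

text \<open>A transition looks at the stack only in \<open>Pop\<close>, where the next state may
  depend on the popped symbol. Natural emissions keep all weights polynomial in u.\<close>

locale pushdown =
  fixes X :: "'x set" and P :: "'p set" and \<Gamma> :: "'g set"
    and act :: "'x \<Rightarrow> 'p \<Rightarrow> ('p, 'g) action" and em :: "'x \<Rightarrow> 'p \<Rightarrow> nat"
  assumes finite_X: "finite X" and finite_P: "finite P"
    and Stay_closed: "x \<in> X \<Longrightarrow> p \<in> P \<Longrightarrow> act x p = Stay p' \<Longrightarrow> p' \<in> P"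
    and Push_closed: "x \<in> X \<Longrightarrow> p \<in> P \<Longrightarrow> act x p = Push p' g \<Longrightarrow> p' \<in> P \<and> g \<in> \<Gamma>"
    and Pop_closed: "x \<in> X \<Longrightarrow> p \<in> P \<Longrightarrow> act x p = Pop f \<Longrightarrow> g \<in> \<Gamma> \<Longrightarrow> f g \<in> P"
begin

fun emission :: "'p \<Rightarrow> 'x list \<Rightarrow> 'p \<Rightarrow> 'g list \<Rightarrow> nat option" where
  "emission q [] p st = (if p = q \<and> st = [] then Some 0 else None)"
| "emission q (x # w) p st = map_option ((+) (em x p)) (proceed (emission q w) None st (act x p))"

definition weight :: "nat \<Rightarrow> 'p \<Rightarrow> 'x list \<Rightarrow> 'p \<Rightarrow> 'g list \<Rightarrow> laurent" where
  "weight u q w p st = (case emission q w p st of None \<Rightarrow> 0 | Some e \<Rightarrow> Poly_Mapping.single (Poly_Mapping.single u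
      (int e)) 1)"

definition run_series :: "nat \<Rightarrow> 'p \<Rightarrow> 'p \<Rightarrow> 'g list \<Rightarrow> series" where
  "run_series u q p st = Abs_fps (\<lambda>k. \<Sum>w | w \<in> lists X \<and> length w = k. weight u q w p st)"

definition Step :: "nat \<Rightarrow> 'p \<Rightarrow> (('p, 'g) action \<Rightarrow> series) \<Rightarrow> series" where
  "Step u p h = (\<Sum>x\<in>X. tpow u (int (em x p)) * h (act x p))"

lemma weight_Cons: "weight u q (x # w) p st =
    Poly_Mapping.single (Poly_Mapping.single u (int (em x p))) 1 * proceed (weight u q w) 0 st (act x p)"
proof -
  have "weight u q (x # w) p st = (case proceed (emission q w) None st (act x p) of None \<Rightarrow> 0 | Some e \<Rightarrow>
      Poly_Mapping.single (Poly_Mapping.single u (int (em x p) + int e)) 1)"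
    by (simp add: weight_def split: option.split)
  also have "\<dots> = Poly_Mapping.single (Poly_Mapping.single u (int (em x p))) 1 *
      (case proceed (emission q w) None st (act x p) of None \<Rightarrow> 0 | Some e \<Rightarrow> Poly_Mapping.single
          (Poly_Mapping.single u (int e)) 1)"
    by (simp add: mult_single single_add split: option.split)
  also have "(case proceed (emission q w) None st (act x p) of None \<Rightarrow> 0 | Some e \<Rightarrow> Poly_Mapping.single
      (Poly_Mapping.single u (int e)) 1)
      = proceed (weight u q w) 0 st (act x p)"
    by (simp add: proceed_def weight_def split: action.split list.split)
  finally show ?thesis .
qed

lemma words_Suc: "{w. w \<in> lists X \<and> length w = Suc k} = (\<lambda>(x, w). x # w) ` (X \<times> {w. w \<in> lists X \<and> length w = k})"
  by (auto simp: length_Suc_conv image_iff)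

lemma run_series_nth_0: "run_series u q p st $ 0 = (if p = q \<and> st = [] then 1 else 0)"
proof -
  have "{w. w \<in> lists X \<and> length w = 0} = {[]}" by auto
  then show ?thesis by (simp add: run_series_def weight_def)
qed

lemma run_series_nth_Suc: "run_series u q p st $ Suc k = (\<Sum>x\<in>X. Poly_Mapping.single (Poly_Mapping.single u (int
    (em x p))) 1
    * (proceed (run_series u q) 0 st (act x p) $ k))"
proof -
  have "run_series u q p st $ Suc k = (\<Sum>(x, w)\<in>X \<times> {w. w \<in> lists X \<and> length w = k}. weight u q (x # w) p st)"
    unfolding run_series_def fps_nth_Abs_fps words_Suc by (subst sum.reindex) (auto simp: inj_on_def case_prod_beta)
  also have "\<dots> = (\<Sum>x\<in>X. \<Sum>w | w \<in> lists X \<and> length w = k. weight u q (x # w) p st)"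
    by (rule sum.cartesian_product[symmetric])
  also have "\<dots> = (\<Sum>x\<in>X. Poly_Mapping.single (Poly_Mapping.single u (int (em x p))) 1
    * (proceed (run_series u q) 0 st (act x p) $ k))"
    unfolding weight_Cons sum_distrib_left[symmetric]
    by (intro sum.cong HOL.refl arg_cong2[of _ _ _ _ "(*)"])
      (simp add: proceed_def run_series_def split: action.split list.split)
  finally show ?thesis .
qed

lemma Step_nth: "Step u p h $ k = (\<Sum>x\<in>X. Poly_Mapping.single (Poly_Mapping.single u (int (em x p))) 1 * (h (act
    x p) $ k))"
  by (simp add: Step_def fps_sum_nth tpow_def)

text \<open>The factor \<open>fps_X\<close> makes the recursion contracting: the coefficient at
  \<open>Suc k\<close> involves only coefficients at \<open>k\<close>, for all states and stacks
  simultaneously.\<close>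

lemma run_series_unique:
  assumes W: "\<And>p st. p \<in> P \<Longrightarrow> st \<in> lists \<Gamma> \<Longrightarrow>
      W p st = (if p = q \<and> st = [] then 1 else 0) + fps_X * Step u p (proceed W 0 st)"
    and p: "p \<in> P" "st \<in> lists \<Gamma>"
  shows "run_series u q p st = W p st"
proof -
  have "run_series u q p st $ k = W p st $ k" if "p \<in> P" "st \<in> lists \<Gamma>" for p st k
    using that
  proof (induction k arbitrary: p st)
    case 0
    then show ?case by (subst W) (auto simp: run_series_nth_0)
  next
    case (Suc k)
    have "W p st $ Suc k = Step u p (proceed W 0 st) $ k"
      using Suc.prems by (subst W) auto
    also have "\<dots> = run_series u q p st $ Suc k"
      unfolding Step_nth run_series_nth_Suc
    proof (intro sum.cong HOL.refl arg_cong2[of _ _ _ _ "(*)"])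
      fix x assume x: "x \<in> X"
      show "proceed W 0 st (act x p) $ k = proceed (run_series u q) 0 st (act x p) $ k"
      proof (cases "act x p")
        case (Stay p')
        then show ?thesis using Suc.IH[of p' st] Stay_closed[OF x Suc.prems(1)] Suc.prems
          by (simp add: proceed_def)
      next
        case (Push p' g)
        then show ?thesis using Suc.IH[of p' "g # st"] Push_closed[OF x Suc.prems(1)] Suc.prems
          by (simp add: proceed_def)
      next
        case (Pop f)
        then show ?thesis using Suc.IH[of "f (hd st)" "tl st"] Pop_closed[OF x Suc.prems(1), of f "hd st"] Suc.prems
          by (cases st) (simp_all add: proceed_def)
      qed
    qed
    finally show ?case by simp
  qed
  then show ?thesis using p by (simp add: fps_eq_iff)
qed

text \<open>\<open>E p q\<close> counts the runs from \<open>p\<close> to \<open>q\<close> that never go below the initial stack. Splitting a run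
  that starts with a push at the first return to its initial level gives a quadratic system.\<close>

definition Phi :: "nat \<Rightarrow> ('p \<Rightarrow> 'p \<Rightarrow> series) \<Rightarrow> 'p \<Rightarrow> 'p \<Rightarrow> series" where
  "Phi u E p q = Step u p (\<lambda>a. case a of Stay p' \<Rightarrow> E p' q
     | Push p' g \<Rightarrow> (\<Sum>r\<in>P. E p' r * (fps_X * Step u r (on_pop (\<lambda>f. E (f g) q)))) | Pop f \<Rightarrow> 0)"

text \<open>A run that empties \<open>g # st\<close> is cut at the moment \<open>g\<close> is
  popped: an \<open>E\<close>-run above \<open>g\<close>, one popping letter, and a run on
  \<open>st\<close>.\<close>

fun stacked :: "nat \<Rightarrow> ('p \<Rightarrow> 'p \<Rightarrow> series) \<Rightarrow> 'p \<Rightarrow> 'p \<Rightarrow> 'g list \<Rightarrow> series" where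
  "stacked u E q p [] = E p q"
| "stacked u E q p (g # st) = (\<Sum>r\<in>P. E p r * (fps_X * Step u r (on_pop (\<lambda>f. stacked u E q (f g) st))))"

lemma Step_add: "Step u p h + Step u p h' = Step u p (\<lambda>a. h a + h' a)"
  by (simp add: Step_def sum.distrib distrib_left)

lemma Step_mult: "Step u p h * c = Step u p (\<lambda>a. h a * c)"
  by (simp add: Step_def sum_distrib_right mult.assoc)

lemma Step_sum: "(\<Sum>r\<in>A. Step u p (h r)) = Step u p (\<lambda>a. \<Sum>r\<in>A. h r a)"
  unfolding Step_def by (subst sum.swap) (simp add: sum_distrib_left)

lemma on_pop_mult: "on_pop h a * (c::series) = on_pop (\<lambda>f. h f * c) a"
  by (simp add: on_pop_def split: action.split)

lemma on_pop_sum: "(\<Sum>r\<in>A. on_pop (h r) a) = (on_pop (\<lambda>f. \<Sum>r\<in>A. h r f) a :: series)"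
  by (simp add: on_pop_def split: action.split)

text \<open>Provides the recursion required by \<open>run_series_unique\<close>. Unfolding the first
  letter of the initial \<open>E\<close>-run must agree with unfolding the first letter of the whole
  run.\<close>

lemma stacked_rec:
  assumes E: "\<And>p q. p \<in> P \<Longrightarrow> q \<in> P \<Longrightarrow> E p q = (if p = q then 1 else 0) + fps_X * Phi u E p q"
    and p: "p \<in> P" and q: "q \<in> P"
  shows "stacked u E q p st = (if p = q \<and> st = [] then 1 else 0)
    + fps_X * Step u p (proceed (stacked u E q) 0 st)"
proof (cases st)
  case Nil
  have "Phi u E p q = Step u p (proceed (stacked u E q) 0 [])"
    unfolding Phi_def by (rule arg_cong[of _ _ "Step u p"]) (auto simp: fun_eq_iff proceed_def split: action.split)
  then show ?thesis using Nil E[OF p q] by simp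
next
  case (Cons g st')
  define T where "T r = fps_X * Step u r (on_pop (\<lambda>f. stacked u E q (f g) st'))" for r
  have st: "stacked u E q p' (g # st') = (\<Sum>r\<in>P. E p' r * T r)" for p'
    by (simp add: T_def)
  \<comment> \<open>The comparison for one first action: the sum covers letters that keep
    \<open>g\<close>, the \<open>on_pop\<close> term the letter that removes it at once. After a
    push, both sides cut the run at the same two pops, summed in a different order.\<close>
  have key: "(\<Sum>r\<in>P. (case a of Stay p' \<Rightarrow> E p' r
     | Push p' g \<Rightarrow> (\<Sum>s\<in>P. E p' s * (fps_X * Step u s (on_pop (\<lambda>f. E (f g) r)))) | Pop f \<Rightarrow> 0) * T r)
     + on_pop (\<lambda>f. stacked u E q (f g) st') a = proceed (stacked u E q) 0 st a" for a
  proof (cases a)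
    case (Push p' g')
    have "(\<Sum>r\<in>P. (\<Sum>s\<in>P. E p' s * (fps_X * Step u s (on_pop (\<lambda>f. E (f g') r)))) * T r)
      = (\<Sum>s\<in>P. \<Sum>r\<in>P. E p' s * (fps_X * (Step u s (on_pop (\<lambda>f. E (f g') r)) * T r)))"
      unfolding sum_distrib_right by (subst sum.swap) (simp only: mult.assoc)
    also have "\<dots> = (\<Sum>s\<in>P. E p' s * (fps_X * (\<Sum>r\<in>P. Step u s (on_pop (\<lambda>f. E (f g') r)) * T r)))"
      by (simp only: sum_distrib_left)
    also have "\<dots> = (\<Sum>s\<in>P. E p' s * (fps_X * Step u s (on_pop (\<lambda>f. \<Sum>r\<in>P. E (f g') r * T r))))"
      unfolding Step_mult Step_sum on_pop_mult on_pop_sum ..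
    also have "\<dots> = stacked u E q p' (g' # g # st')"
      unfolding st[symmetric] by simp
    finally show ?thesis using Push Cons by (simp add: proceed_def on_pop_def)
  qed (auto simp: proceed_def on_pop_def Cons st T_def)
  have "stacked u E q p st = (\<Sum>r\<in>P. ((if p = r then 1 else 0) + fps_X * Phi u E p r) * T r)"
    using E[OF p] unfolding Cons st by (intro sum.cong) auto
  also have "\<dots> = (\<Sum>r\<in>P. (if p = r then T r else 0)) + fps_X * (\<Sum>r\<in>P. Phi u E p r * T r)"
    by (simp add: distrib_right sum.distrib sum_distrib_left mult.assoc if_distrib[of "\<lambda>c. c * _"] cong: if_cong)
  also have "(\<Sum>r\<in>P. (if p = r then T r else 0)) = T p"
    using p finite_P by simp
  also have "T p + fps_X * (\<Sum>r\<in>P. Phi u E p r * T r)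
      = fps_X * (Step u p (on_pop (\<lambda>f. stacked u E q (f g) st')) + (\<Sum>r\<in>P. Phi u E p r * T r))"
    by (simp add: T_def distrib_left)
  also have "Step u p (on_pop (\<lambda>f. stacked u E q (f g) st')) + (\<Sum>r\<in>P. Phi u E p r * T r)
      = Step u p (proceed (stacked u E q) 0 st)"
    unfolding Phi_def Step_mult Step_sum Step_add key[symmetric] by (simp only: add.commute)
  finally show ?thesis by (simp add: Cons)
qed

theorem pushdown_diagonal:
  assumes p0: "p0 \<in> P" and Fin: "Fin \<subseteq> P"
  shows "\<exists>n r. rational_mps (Suc n) r \<and>
    diagonal (Suc n) r = Abs_fps (\<lambda>k. of_nat (\<Sum>q\<in>Fin. card {w \<in> lists X. length w = k \<and> emission q w p0 []
        = Some k}))"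
proof -
  define N where "N = card (P \<times> P)"
  obtain idx where "bij_betw idx (P \<times> P) {0..<N}"
    unfolding N_def using ex_bij_betw_finite_nat[of "P \<times> P"] finite_P by auto
  then have idx: "bij_betw idx (P \<times> P) {..<N}" by (simp add: atLeast0LessThan)
  define I where "I = {..<N}"
  \<comment> \<open>The variables below \<open>N\<close> are the unknowns and \<open>N\<close>
    itself is u.\<close>
  define s where "s = Suc N"
  \<comment> \<open>The system needs right-hand sides divisible by z, so the unknown is
    \<open>E p q\<close> without the empty run, which is added back here.\<close>
  define E0 where "E0 p q = (if p \<in> P \<and> q \<in> P then (if p = q then 1 else 0) + tpow (idx (p, q)) 1 else 0)" for p q
  define \<phi> where "\<phi> i = (let (p, q) = the_inv_into (P \<times> P) idx i in Phi N E0 p q)" for i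
  have idx_less: "idx (p, q) < N" if "p \<in> P" "q \<in> P" for p q
    using bij_betwE[OF idx] that by auto
  have E0_polys: "E0 p q \<in> polys s {}" for p q
    using idx_less by (auto simp: E0_def s_def intro!: polys_add polys_tpow less_SucI)
  have u_polys: "tpow N (int e) \<in> polys s {}" for e by (rule polys_tpow) (simp_all add: s_def)
  have Step_polys: "Step N p h \<in> polys s {}" if "\<And>a. h a \<in> polys s {}" for p h
    unfolding Step_def using that by (intro polys_sum polys_mult u_polys)
  have on_pop_polys: "on_pop h a \<in> polys s {}" if "\<And>f. h f \<in> polys s {}" for h :: "('g \<Rightarrow> 'p) \<Rightarrow> series" and a
    using that by (simp add: on_pop_def split: action.split)
  have Phi_polys: "Phi N E0 p q \<in> polys s {}" for p q
    unfolding Phi_def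
    by (intro Step_polys) (auto split: action.split intro!: polys_sum polys_mult Step_polys on_pop_polys E0_polys)
  have \<phi>_polys: "\<phi> i \<in> polys s {}" for i by (simp add: \<phi>_def Phi_polys split: prod.split)
  obtain \<Lambda> J where J: "J \<in> fracs s {}" and elim: "eliminates I \<phi> \<Lambda> J"
    using elimination_exists[of I "fracs s {}" \<phi>] closed_class_fracs polys_fracs[OF \<phi>_polys]
    by (auto simp: I_def)
  have polys_nn: "f \<in> supported (expnn I)" if "f \<in> polys s {}" for f
    using closed_class_fracs[of I s] polys_fracs[OF that] unfolding closed_class_def by blast
  have hom: "\<Lambda> (G + H) = \<Lambda> G + \<Lambda> H" "\<Lambda> (G * H) = \<Lambda> G * \<Lambda> H" if "G \<in> polys s {}" "H \<in> polys s {}" for G H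
    using elim polys_nn that unfolding eliminates_def by blast+
  have fixed: "\<Lambda> C = C" if "C \<in> supported (expzero I)" for C
    using elim that unfolding eliminates_def by blast
  have hom_sum: "\<Lambda> (sum f A) = (\<Sum>a\<in>A. \<Lambda> (f a))" if "\<And>a. f a \<in> polys s {}" for f :: "'z \<Rightarrow> series" and A
    using that by (induction A rule: infinite_finite_induct) (simp_all add: fixed hom polys_sum)
  have u_fixed: "\<Lambda> (tpow N e) = tpow N e" for e
    by (rule fixed) (simp add: tpow_in_expzero I_def)
  define E where "E p q = \<Lambda> (E0 p q)" for p q
  have Step_hom: "\<Lambda> (Step N p h) = Step N p (\<lambda>a. \<Lambda> (h a))" if "\<And>a. h a \<in> polys s {}" for p h
    unfolding Step_def using that by (simp add: hom_sum hom u_fixed polys_mult u_polys)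
  have on_pop_hom: "\<Lambda> (on_pop h a) = on_pop (\<lambda>f. \<Lambda> (h f)) a" for h :: "('g \<Rightarrow> 'p) \<Rightarrow> series" and a
    by (simp add: on_pop_def fixed split: action.split)
  have X_hom: "\<Lambda> (fps_X * G) = fps_X * \<Lambda> G" if "G \<in> polys s {}" for G
    using that by (simp add: hom fixed)
  have Phi_hom: "\<Lambda> (Phi N E0 p q) = Phi N E p q" for p q
  proof -
    have inner: "\<Lambda> (fps_X * Step N r (on_pop (\<lambda>f. E0 (f g) q))) = fps_X * Step N r (on_pop (\<lambda>f. E (f g) q))" for r g
      using E0_polys by (simp add: X_hom Step_hom Step_polys on_pop_polys on_pop_hom E_def)
    have inner_polys: "fps_X * Step N r (on_pop (\<lambda>f. E0 (f g) q)) \<in> polys s {}" for r g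
      using E0_polys by (intro polys_mult Step_polys on_pop_polys) auto
    show ?thesis
      unfolding Phi_def
    proof (subst Step_hom)
      show "(case a of Stay p' \<Rightarrow> E0 p' q
         | Push p' g \<Rightarrow> (\<Sum>r\<in>P. E0 p' r * (fps_X * Step N r (on_pop (\<lambda>f. E0 (f g) q)))) | Pop f \<Rightarrow> 0) \<in> polys s {}" for a
        by (simp add: polys_sum polys_mult[OF E0_polys inner_polys] E0_polys split: action.split)
    qed (rule arg_cong[of _ _ "Step N p"],
      auto simp: fun_eq_iff hom_sum hom inner polys_mult E0_polys inner_polys E_def[symmetric] fixed split:
          action.split)
  qed
  have E: "E p q = (if p = q then 1 else 0) + fps_X * Phi N E p q" if "p \<in> P" "q \<in> P" for p q
  proof -
    have i: "idx (p, q) \<in> I" using idx_less that by (simp add: I_def)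
    have "the_inv_into (P \<times> P) idx (idx (p, q)) = (p, q)"
      using idx that by (intro the_inv_into_f_f) (auto simp: bij_betw_def)
    then have "\<phi> (idx (p, q)) = Phi N E0 p q" by (simp add: \<phi>_def)
    then have "\<Lambda> (tpow (idx (p, q)) 1) = fps_X * Phi N E p q"
      using elim i X_hom[OF Phi_polys] Phi_hom unfolding eliminates_def by metis
    moreover have "tpow (idx (p, q)) 1 \<in> polys s {}"
      using idx_less[OF that] by (intro polys_tpow) (simp_all add: s_def)
    moreover have "\<Lambda> (if p = q then 1 else 0) = (if p = q then 1 else 0)" by (simp add: fixed)
    ultimately show ?thesis
      using that by (simp add: E_def E0_def hom)
  qed
  have run_series: "run_series N q p0 [] = E p0 q" if "q \<in> P" for q
    using run_series_unique[of "stacked N E q" q N p0 "[]", OF stacked_rec[OF E _ that]] p0 by simp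
  define G where "G = (\<Sum>q\<in>Fin. E0 p0 q)"
  have G: "G \<in> polys s {}" unfolding G_def by (intro polys_sum E0_polys)
  define Q where "Q = G * J * (\<Prod>i\<in>I. geom (tpow i (- 1) * (fps_X * \<phi> i)))"
  have Q: "Q \<in> fracs s I"
    unfolding Q_def
  proof (rule fracs_mult[OF fracs_mult fracs_prod[OF fracs_geom]])
    show "G \<in> fracs s I" "J \<in> fracs s I" using G J by (auto intro: fracs_mono polys_fracs)
    fix i assume i: "i \<in> I"
    \<comment> \<open>This is where negative exponents enter: one inverse variable for one factor
      z.\<close>
    have "tpow i (- 1) * fps_X \<in> supported (expbound s I)"
    proof (rule supportedI)
      fix k show "keys ((tpow i (- 1) * fps_X) $ k) \<subseteq> expbound s I k"
        using i by (auto simp: tpow_def fps_X_def expbound_def lookup_single when_def I_def s_def split: if_splits)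
    qed
    then have "tpow i (- 1) * fps_X \<in> polys s I"
      by (simp add: polys_def zpoly_mult)
    then have "tpow i (- 1) * fps_X * \<phi> i \<in> fracs s I"
      using \<phi>_polys by (intro fracs_mult[OF polys_fracs]) (auto intro: fracs_mono polys_fracs)
    then show "tpow i (- 1) * (fps_X * \<phi> i) \<in> fracs s I" by (simp only: mult.assoc)
  qed simp
  have "(\<Sum>q\<in>Fin. run_series N q p0 []) = (\<Sum>q\<in>Fin. E p0 q)" using run_series Fin by (intro sum.cong) auto
  also have "\<dots> = \<Lambda> G" unfolding G_def E_def by (simp add: hom_sum E0_polys)
  also have "\<dots> = CT I Q" using elim polys_nn[OF G] unfolding eliminates_def Q_def by blast
  finally have CT: "(\<Sum>q\<in>Fin. run_series N q p0 []) = CT I Q" .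
  \<comment> \<open>The monomial u^k has exponent 0 in all eliminated variables, so its coefficient
    in \<open>Q\<close> is already the one in the constant term.\<close>
  have coeff: "lookup (Q $ k) (Poly_Mapping.single N (int k)) =
      int (\<Sum>q\<in>Fin. card {w \<in> lists X. length w = k \<and> emission q w p0 [] = Some k})" for k
  proof -
    have fin: "finite {w. w \<in> lists X \<and> length w = k}"
      using finite_lists_length_eq[OF finite_X, of k] by (simp add: lists_eq_set)
    have "lookup (Q $ k) (Poly_Mapping.single N (int k)) = lookup (CT I Q $ k) (Poly_Mapping.single N (int k))"
      by (auto simp: ct0.rep_eq lookup_single I_def)
    also have "\<dots> = (\<Sum>q\<in>Fin. \<Sum>w | w \<in> lists X \<and> length w = k. lookup (weight N q w p0 []) (Poly_Mapping.single N
        (int k)))"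
      unfolding CT[symmetric] by (simp add: fps_sum_nth run_series_def lookup_sum)
    also have "\<dots> = (\<Sum>q\<in>Fin. \<Sum>w | w \<in> lists X \<and> length w = k. if emission q w p0 [] = Some k then 1 else 0)"
      by (intro sum.cong HOL.refl)
        (auto simp: weight_def lookup_single when_def split: option.split dest: arg_cong[of _ _ "\<lambda>m. lookup m N"])
    also have "\<dots> = int (\<Sum>q\<in>Fin. card {w \<in> lists X. length w = k \<and> emission q w p0 [] = Some k})"
      using fin by (simp add: sum.inter_filter[symmetric] conj_assoc)
    finally show ?thesis .
  qed
  obtain r where "rational_mps (Suc s) r"
    "diagonal (Suc s) r = Abs_fps (\<lambda>k. of_int (lookup (Q $ k) (\<Sum>i\<in>{..<s} - I. Poly_Mapping.single i (int k))))"
    using fracs_diagonal[OF Q] by blast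
  moreover have "{..<s} - I = {N}" by (auto simp: s_def I_def)
  ultimately show ?thesis
    by (auto simp: coeff)
qed

end

section \<open>Local actions on stacks\<close>

text \<open>The features of right multiplication by a letter of \<open>X\<close> on normal forms
  that the pushdown machine needs. \<open>L\<close> bounds how deep a letter reads and how much it
  adds, \<open>D\<close> is a period of the counter and bounds its decrease, and by
  \<open>above\<close> the reading depth is always available.\<close>

locale local_action =
  fixes X :: "'x set" and \<Gamma> :: "'g set" and act :: "'x \<Rightarrow> 'g list \<times> int \<Rightarrow> 'g list \<times> int"
    and L :: nat and D :: int and \<sigma>0 :: "'g list"
  assumes finite_X: "finite X" and finite_\<Gamma>: "finite \<Gamma>" and L_pos: "L > 0" and D_pos: "D > 0"
    and local: "x \<in> X \<Longrightarrow> L \<le> length \<tau> \<Longrightarrow>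
      act x (\<tau> @ \<rho>, j) = (fst (act x (\<tau>, j)) @ \<rho>, snd (act x (\<tau>, j)))"
    and length_act: "x \<in> X \<Longrightarrow> length (fst (act x (\<tau>, j))) \<le> length \<tau> + L"
    and set_act: "x \<in> X \<Longrightarrow> set \<tau> \<subseteq> \<Gamma> \<Longrightarrow> set (fst (act x (\<tau>, j))) \<subseteq> \<Gamma>"
    and period: "x \<in> X \<Longrightarrow> act x (\<tau>, j + D * c) = (fst (act x (\<tau>, j)), snd (act x (\<tau>, j)) + D * c)"
    and bound: "x \<in> X \<Longrightarrow> set \<tau> \<subseteq> \<Gamma> \<Longrightarrow> j - D \<le> snd (act x (\<tau>, j))"
    and \<sigma>0: "length \<sigma>0 = L" "set \<sigma>0 \<subseteq> \<Gamma>"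
    and above: "w \<in> lists X \<Longrightarrow> L \<le> length (fst (fold act w (\<sigma>0, 0)))"
begin

lemma fold_period: "w \<in> lists X \<Longrightarrow>
    fold act w (\<tau>, j + D * c) = (fst (fold act w (\<tau>, j)), snd (fold act w (\<tau>, j)) + D * c)"
proof (induction w arbitrary: \<tau> j)
  case (Cons x w)
  then show ?case
    using period[of x \<tau> j c] Cons.IH[of "fst (act x (\<tau>, j))" "snd (act x (\<tau>, j))"] by simp
qed simp

lemma fold_bound: "w \<in> lists X \<Longrightarrow> set \<tau> \<subseteq> \<Gamma> \<Longrightarrow> j - D * int (length w) \<le> snd (fold act w (\<tau>, j))"
proof (induction w arbitrary: \<tau> j)
  case (Cons x w)
  then show ?case
    using bound[of x \<tau> j] set_act[of x \<tau> j] Cons.IH[of "fst (act x (\<tau>, j))" "snd (act x (\<tau>, j))"]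
    by (simp add: algebra_simps)
qed simp

text \<open>The top of the stack, of length between \<open>L\<close> and \<open>2L - 1\<close>, is kept in the control state and the
  rest is cut into blocks of length \<open>L\<close>, so that a letter pushes or pops at most one block; the
  counter is kept modulo \<open>D\<close> in the control state, and its carry, which is at least \<open>-1\<close>, is
  emitted increased by \<open>1\<close>.\<close>

definition block_act :: "(nat \<Rightarrow> 'x \<Rightarrow> nat) \<Rightarrow> 'x \<Rightarrow> 'g list \<times> int \<times> nat \<Rightarrow> ('g list \<times> int \<times> nat, 'g list) action" where
  "block_act \<delta> x = (\<lambda>(\<beta>, b, q).
     let \<beta>' = fst (act x (\<beta>, b)); b' = snd (act x (\<beta>, b)) mod D; q' = \<delta> q x; m = length \<beta>' - L in
     if length \<beta>' < L then Pop (\<lambda>\<gamma>. (\<beta>' @ \<gamma>, b', q'))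
     else if length \<beta>' < 2 * L then Stay (\<beta>', b', q')
     else Push (take m \<beta>', b', q') (drop m \<beta>'))"

definition block_em :: "'x \<Rightarrow> 'g list \<times> int \<times> nat \<Rightarrow> nat" where
  "block_em x = (\<lambda>(\<beta>, b, q). nat (snd (act x (\<beta>, b)) div D + 1))"

text \<open>The window from \<open>L\<close> to \<open>2 * L - 1\<close> is stable: a letter raises
  the length to at most \<open>3 * L - 1\<close>, and then pushing one block suffices; below
  \<open>L\<close>, one popped block restores it.\<close>

definition states :: "nat set \<Rightarrow> ('g list \<times> int \<times> nat) set" where
  "states S = {\<beta>. set \<beta> \<subseteq> \<Gamma> \<and> L \<le> length \<beta> \<and> length \<beta> < 2 * L} \<times> {0..<D} \<times> S"

definition blocks :: "'g list set" where
  "blocks = {\<gamma>. set \<gamma> \<subseteq> \<Gamma> \<and> length \<gamma> = L}"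

lemma finite_states: "finite S \<Longrightarrow> finite (states S)"
proof -
  assume S: "finite S"
  have "finite {\<beta>. set \<beta> \<subseteq> \<Gamma> \<and> length \<beta> \<le> 2 * L}" by (rule finite_lists_length_le[OF finite_\<Gamma>])
  then have "finite {\<beta>. set \<beta> \<subseteq> \<Gamma> \<and> L \<le> length \<beta> \<and> length \<beta> < 2 * L}"
    by (rule finite_subset[rotated]) auto
  then show ?thesis using S unfolding states_def by (intro finite_cartesian_product) auto
qed

context
  fixes S :: "nat set" and \<delta> :: "nat \<Rightarrow> 'x \<Rightarrow> nat"
  assumes finite_S: "finite S" and \<delta>: "\<And>q x. q \<in> S \<Longrightarrow> x \<in> X \<Longrightarrow> \<delta> q x \<in> S"
begin

lemma block_pushdown: "pushdown X (states S) blocks (block_act \<delta>)"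
proof
  show "finite X" "finite (states S)" using finite_X finite_states[OF finite_S] by auto
next
  fix x p p' assume x: "x \<in> X" and p: "p \<in> states S" and a: "block_act \<delta> x p = Stay p'"
  obtain \<beta> b q where p_eq: "p = (\<beta>, b, q)" by (cases p)
  have "set (fst (act x (\<beta>, b))) \<subseteq> \<Gamma>" using set_act[OF x] p by (simp add: p_eq states_def)
  then show "p' \<in> states S"
    using a p x \<delta> D_pos by (auto simp: block_act_def states_def Let_def p_eq split: if_splits)
next
  fix x p p' g assume x: "x \<in> X" and p: "p \<in> states S" and a: "block_act \<delta> x p = Push p' g"
  obtain \<beta> b q where p_eq: "p = (\<beta>, b, q)" by (cases p)
  define \<beta>' where "\<beta>' = fst (act x (\<beta>, b))"
  have "set \<beta>' \<subseteq> \<Gamma>" "length \<beta>' \<le> length \<beta> + L"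
    using set_act[OF x] length_act[OF x] p by (auto simp: \<beta>'_def p_eq states_def)
  then show "p' \<in> states S \<and> g \<in> blocks"
    using a p x \<delta> D_pos L_pos set_take_subset[of "length \<beta>' - L" \<beta>'] set_drop_subset[of "length \<beta>' - L" \<beta>']
    by (auto simp: block_act_def states_def blocks_def Let_def p_eq \<beta>'_def[symmetric] split: if_splits)
next
  fix x p f g assume x: "x \<in> X" and p: "p \<in> states S" and a: "block_act \<delta> x p = Pop f" and g: "g \<in> blocks"
  obtain \<beta> b q where p_eq: "p = (\<beta>, b, q)" by (cases p)
  have "set (fst (act x (\<beta>, b))) \<subseteq> \<Gamma>" using set_act[OF x] p by (simp add: p_eq states_def)
  then show "f g \<in> states S"
    using a g p x \<delta> D_pos by (auto simp: block_act_def states_def blocks_def Let_def p_eq split: if_splits)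
qed

interpretation pushdown X "states S" blocks "block_act \<delta>" block_em
  by (rule block_pushdown)

text \<open>Each emission exceeds the carry by one, so \<open>int e - int (length w)\<close> is the
  total carry, and with final remainder 0 the counter is \<open>D\<close> times it. The last
  assumption guarantees that a pop never meets an empty stack.\<close>

lemma emission_iff:
  assumes "w \<in> lists X" "(\<beta>, b, q) \<in> states S" "st \<in> lists blocks"
    "\<And>v. v \<in> lists X \<Longrightarrow> L \<le> length (fst (fold act v (\<beta> @ concat st, b)))"
  shows "emission (\<sigma>0, 0, f) w (\<beta>, b, q) st = Some e \<longleftrightarrow>
    fold act w (\<beta> @ concat st, b) = (\<sigma>0, D * (int e - int (length w))) \<and> foldl \<delta> q w = f"
  using assms
proof (induction w arbitrary: \<beta> b q st e rule: list.induct)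
  case Nil
  have \<beta>: "L \<le> length \<beta>" "0 \<le> b" "b < D" using Nil.prems by (auto simp: states_def)
  show ?case
  proof
    assume "emission (\<sigma>0, 0, f) [] (\<beta>, b, q) st = Some e"
    then show "fold act [] (\<beta> @ concat st, b) = (\<sigma>0, D * (int e - int (length []))) \<and> foldl \<delta> q [] = f"
      by (auto split: if_splits)
  next
    assume *: "fold act [] (\<beta> @ concat st, b) = (\<sigma>0, D * (int e - int (length []))) \<and> foldl \<delta> q [] = f"
    \<comment> \<open>The top part alone already has at least the length \<open>L\<close> of the
      target stack, so no block can lie below it.\<close>
    then have "length (concat st) = 0" using \<beta>(1) \<sigma>0(1) by auto
    moreover have "st \<in> lists blocks" using Nil.prems by blast
    ultimately have "st = []"
      using L_pos by (cases st) (auto simp: blocks_def)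
    moreover have "b = D * int e" using * by simp
    then have "D * int e < D * 1" using \<beta> by simp
    then have "e = 0" unfolding mult_less_cancel_left_pos[OF D_pos] by simp
    ultimately show "emission (\<sigma>0, 0, f) [] (\<beta>, b, q) st = Some e" using * by auto
  qed
next
  case (Cons x w)
  have x: "x \<in> X" and w: "w \<in> lists X" using Cons.prems(1) by auto
  have \<beta>: "set \<beta> \<subseteq> \<Gamma>" "L \<le> length \<beta>" "0 \<le> b" "b < D" "q \<in> S" using Cons.prems(2) by (auto simp: states_def)
  define \<beta>' where "\<beta>' = fst (act x (\<beta>, b))"
  define j where "j = snd (act x (\<beta>, b))"
  have act: "act x (\<beta> @ concat st, b) = (\<beta>' @ concat st, j mod D + D * (j div D))"
    using local[OF x \<beta>(2)] by (simp add: \<beta>'_def j_def)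
  have em: "int (block_em x (\<beta>, b, q)) = j div D + 1"
  proof -
    have "- D \<le> j" using bound[OF x \<beta>(1), of b] \<beta> by (simp add: j_def)
    then have "(- 1 * D) div D \<le> j div D" using D_pos by (intro zdiv_mono1) auto
    then have "- 1 \<le> j div D" unfolding nonzero_mult_div_cancel_right[OF less_imp_neq[OF D_pos, symmetric]] .
    then show ?thesis by (simp add: block_em_def j_def)
  qed
  have run: "fold act v (act x (\<beta> @ concat st, b)) = (fst (fold act v (\<beta>' @ concat st, j mod D)),
      snd (fold act v (\<beta>' @ concat st, j mod D)) + D * (j div D))" if "v \<in> lists X" for v
    unfolding act by (rule fold_period[OF that])
  have above': "L \<le> length (fst (fold act v (\<beta>' @ concat st, j mod D)))" if "v \<in> lists X" for v
    using Cons.prems(4)[of "x # v"] x that run[OF that] by simp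
  have step: "\<exists>\<beta>2 st2. proceed h z st (block_act \<delta> x (\<beta>, b, q)) = h (\<beta>2, j mod D, \<delta> q x) st2 \<and>
      \<beta>2 @ concat st2 = \<beta>' @ concat st \<and> (\<beta>2, j mod D, \<delta> q x) \<in> states S \<and> st2 \<in> lists blocks"
    for h :: "'g list \<times> int \<times> nat \<Rightarrow> 'g list list \<Rightarrow> 'r" and z
  proof -
    have closed: "set \<beta>' \<subseteq> \<Gamma>" "length \<beta>' \<le> length \<beta> + L" "length \<beta> < 2 * L" "\<delta> q x \<in> S" "0 \<le> j mod D" "j mod D < D"
      using set_act[OF x \<beta>(1)] length_act[OF x] Cons.prems(2) \<delta>[OF \<beta>(5) x] D_pos
      by (auto simp: \<beta>'_def states_def)
    have blk: "block_act \<delta> x (\<beta>, b, q) = (if length \<beta>' < L then Pop (\<lambda>\<gamma>. (\<beta>' @ \<gamma>, j mod D, \<delta> q x))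
       else if length \<beta>' < 2 * L then Stay (\<beta>', j mod D, \<delta> q x)
       else Push (take (length \<beta>' - L) \<beta>', j mod D, \<delta> q x) (drop (length \<beta>' - L) \<beta>'))"
      by (simp add: block_act_def Let_def \<beta>'_def j_def)
    consider "length \<beta>' < L" | "L \<le> length \<beta>'" "length \<beta>' < 2 * L" | "2 * L \<le> length \<beta>'" by linarith
    then show ?thesis
    proof cases
      case 1
      then have "st \<noteq> []" using above'[of "[]"] by auto
      then obtain \<gamma> st' where st: "st = \<gamma> # st'" by (cases st) auto
      then have "set \<gamma> \<subseteq> \<Gamma>" "length \<gamma> = L" "st' \<in> lists blocks" using Cons.prems(3) by (auto simp: blocks_def)
      then show ?thesis
        using 1 closed by (intro exI[of _ "\<beta>' @ \<gamma>"] exI[of _ st']) (auto simp: blk proceed_def st states_def)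
    next
      case 2
      then show ?thesis
        using closed Cons.prems(3) by (intro exI[of _ \<beta>'] exI[of _ st]) (auto simp: blk proceed_def states_def)
    next
      case 3
      then show ?thesis
        using closed Cons.prems(3) L_pos set_take_subset[of "length \<beta>' - L" \<beta>'] set_drop_subset[of "length \<beta>' - L" \<beta>']
        by (intro exI[of _ "take (length \<beta>' - L) \<beta>'"] exI[of _ "drop (length \<beta>' - L) \<beta>' # st"])
          (auto simp: blk proceed_def states_def blocks_def)
    qed
  qed
  obtain \<beta>2 st2 where step2: "proceed (emission (\<sigma>0, 0, f) w) None st (block_act \<delta> x (\<beta>, b, q)) =
      emission (\<sigma>0, 0, f) w (\<beta>2, j mod D, \<delta> q x) st2" "\<beta>2 @ concat st2 = \<beta>' @ concat st"
      "(\<beta>2, j mod D, \<delta> q x) \<in> states S" "st2 \<in> lists blocks"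
    using step[of "emission (\<sigma>0, 0, f) w" None] by blast
  have IH: "emission (\<sigma>0, 0, f) w (\<beta>2, j mod D, \<delta> q x) st2 = Some e' \<longleftrightarrow>
    fold act w (\<beta>' @ concat st, j mod D) = (\<sigma>0, D * (int e' - int (length w))) \<and> foldl \<delta> (\<delta> q x) w = f" for e'
    using Cons.IH[OF w step2(3,4)] above' unfolding step2(2) by blast
  \<comment> \<open>This lower bound will show that the emission left for the remaining word is a
    natural number.\<close>
  have fb: "j mod D - D * int (length w) \<le> snd (fold act w (\<beta>' @ concat st, j mod D))"
  proof (rule fold_bound[OF w])
    show "set (\<beta>' @ concat st) \<subseteq> \<Gamma>"
      using set_act[OF x \<beta>(1)] Cons.prems(3) by (auto simp: \<beta>'_def blocks_def)
  qed
  define T where "T = fold act w (\<beta>' @ concat st, j mod D)"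
  have "emission (\<sigma>0, 0, f) (x # w) (\<beta>, b, q) st = Some e \<longleftrightarrow>
      (\<exists>e'. e = block_em x (\<beta>, b, q) + e' \<and> T = (\<sigma>0, D * (int e' - int (length w))) \<and> foldl \<delta> (\<delta> q x) w = f)"
    by (auto simp: step2(1) IH T_def)
  also have "\<dots> \<longleftrightarrow> T = (\<sigma>0, D * (int e - (j div D + 1) - int (length w))) \<and> foldl \<delta> (\<delta> q x) w = f"
  proof
    assume *: "T = (\<sigma>0, D * (int e - (j div D + 1) - int (length w))) \<and> foldl \<delta> (\<delta> q x) w = f"
    then have "- (D * int (length w)) \<le> D * (int e - (j div D + 1) - int (length w))"
      using fb pos_mod_sign[OF D_pos, of j] unfolding T_def[symmetric] by simp
    then have "0 \<le> D * (int e - (j div D + 1))" by (simp add: algebra_simps)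
    then have "0 \<le> int e - int (block_em x (\<beta>, b, q))" using D_pos unfolding em by (simp add: zero_le_mult_iff)
    then obtain e' where "e = block_em x (\<beta>, b, q) + e'" by (metis diff_ge_0_iff_ge le_iff_add of_nat_le_iff)
    then show "\<exists>e'. e = block_em x (\<beta>, b, q) + e' \<and> T = (\<sigma>0, D * (int e' - int (length w))) \<and> foldl \<delta> (\<delta> q x) w = f"
      using * em by (intro exI[of _ e']) auto
  qed (use em in auto)
  also have "\<dots> \<longleftrightarrow> fold act (x # w) (\<beta> @ concat st, b) = (\<sigma>0, D * (int e - int (length (x # w))))
      \<and> foldl \<delta> q (x # w) = f"
    using run[OF w] unfolding T_def[symmetric] by (cases T) (auto simp: algebra_simps)
  finally show ?case .
qed

text \<open>For emission equal to word length the total carry is 0, so the diagonal condition says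
  that stack and counter return to their initial values. The automaton is deterministic, hence
  different final states count disjoint sets of words.\<close>

theorem local_action_diagonal:
  assumes q0: "q0 \<in> S" and F: "F \<subseteq> S"
  shows "\<exists>n r. rational_mps (Suc n) r \<and> diagonal (Suc n) r =
    Abs_fps (\<lambda>k. of_nat (card {w \<in> lists X. length w = k \<and> fold act w (\<sigma>0, 0) = (\<sigma>0, 0) \<and> foldl \<delta> q0 w \<in> F}))"
proof -
  define Fin where "Fin = (\<lambda>f. (\<sigma>0, 0 :: int, f)) ` F"
  have st: "(\<sigma>0, 0, q) \<in> states S" if "q \<in> S" for q
    using \<sigma>0 L_pos D_pos that by (auto simp: states_def)
  have "finite F" using F finite_S by (rule finite_subset)
  have emission0: "emission (\<sigma>0, 0, f) w (\<sigma>0, 0, q0) [] = Some k \<longleftrightarrow> fold act w (\<sigma>0, 0) = (\<sigma>0, 0) \<and> foldl \<delta> q0 w = f"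
    if "w \<in> lists X" "length w = k" for w k f
    using emission_iff[OF that(1) st[OF q0], of "[]" f k] above that D_pos by simp
  have "(\<Sum>q\<in>Fin. card {w \<in> lists X. length w = k \<and> emission q w (\<sigma>0, 0, q0) [] = Some k}) =
      card {w \<in> lists X. length w = k \<and> fold act w (\<sigma>0, 0) = (\<sigma>0, 0) \<and> foldl \<delta> q0 w \<in> F}" for k
  proof -
    define A where "A f = {w \<in> lists X. length w = k \<and> fold act w (\<sigma>0, 0) = (\<sigma>0, 0) \<and> foldl \<delta> q0 w = f}" for f
    have fin: "finite (A f)" for f
      using finite_lists_length_eq[OF finite_X, of k] by (rule finite_subset[rotated]) (auto simp: A_def)
    have "(\<Sum>q\<in>Fin. card {w \<in> lists X. length w = k \<and> emission q w (\<sigma>0, 0, q0) [] = Some k}) = (\<Sum>f\<in>F. card (A f))"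
      unfolding Fin_def A_def using emission0
      by (subst sum.reindex) (auto simp: inj_on_def intro!: sum.cong arg_cong[of _ _ card])
    also have "\<dots> = card (\<Union>f\<in>F. A f)"
      using \<open>finite F\<close> fin by (intro card_UN_disjoint[symmetric]) (auto simp: A_def)
    also have "(\<Union>f\<in>F. A f) = {w \<in> lists X. length w = k \<and> fold act w (\<sigma>0, 0) = (\<sigma>0, 0) \<and> foldl \<delta> q0 w \<in> F}"
      by (auto simp: A_def)
    finally show ?thesis .
  qed
  moreover have "Fin \<subseteq> states S" using F st by (auto simp: Fin_def)
  ultimately show ?thesis using pushdown_diagonal[OF st[OF q0], of Fin] by simp
qed

end

end

section \<open>The word problem of Baumslag--Solitar groups\<close>

declare pres_eq.trans [trans]

lemma pres_eq_append: "pres_eq r u u' \<Longrightarrow> pres_eq r v v' \<Longrightarrow> pres_eq r (u @ v) (u' @ v')"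
  by (meson pres_eq.trans pres_eq_append_left pres_eq_append_right)

lemma pres_eq_context: "pres_eq r u u' \<Longrightarrow> pres_eq r (l @ u @ v) (l @ u' @ v)"
  by (intro pres_eq_append pres_eq.refl)

lemma pres_eq_cancel2: "pres_eq r ([(x, b)] @ [(x, \<not> b)]) []"
  using pres_eq.cancel[of r "[]" x b "[]"] by simp

lemma gen_power_0 [simp]: "gen_power x 0 = []"
  by (simp add: gen_power_def)

lemma gen_power_signed: "gen_power x (if b then int n else - int n) = replicate n (x, b)"
  by (auto simp: gen_power_def)

lemma pres_eq_gen_power_step: "pres_eq r (gen_power x k @ [(x, b)]) (gen_power x (if b then k + 1 else k - 1))"
proof -
  obtain c n where k: "k = (if c then int n else - int n)"
    by (metis int_cases2)
  show ?thesis
  proof (cases "c = b \<or> n = 0")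
    case True
    have "gen_power x k @ [(x, b)] = replicate (Suc n) (x, b)"
      unfolding k gen_power_signed using True by (auto simp: replicate_append_same)
    also have "\<dots> = gen_power x (if b then int (Suc n) else - int (Suc n))"
      by (simp only: gen_power_signed)
    also have "(if b then int (Suc n) else - int (Suc n)) = (if b then k + 1 else k - 1)"
      using True k by auto
    finally show ?thesis by (simp add: pres_eq.refl)
  next
    case False
    then obtain m where m: "n = Suc m" by (cases n) auto
    have c: "c = (\<not> b)" using False by auto
    have "gen_power x k @ [(x, b)] = replicate m (x, c) @ [(x, c), (x, b)] @ []"
      unfolding k gen_power_signed m using replicate_append_same[of m "(x, c)"] by simp
    moreover have "pres_eq r (replicate m (x, c) @ [(x, c), (x, b)] @ []) (replicate m (x, c) @ [])"
      using pres_eq.cancel[of r "replicate m (x, c)" x c "[]"] c by simp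
    moreover have "(if b then k + 1 else k - 1) = (if c then int m else - int m)"
      unfolding k m using c by simp
    ultimately show ?thesis by (simp only: gen_power_signed append_Nil2)
  qed
qed

lemma gen_power_add: "pres_eq r (gen_power x k @ gen_power x l) (gen_power x (k + l))"
proof -
  have nat: "pres_eq r (gen_power x k @ replicate n (x, b)) (gen_power x (if b then k + int n else k - int n))"
      for n b
  proof (induction n)
    case (Suc n)
    have "pres_eq r ((gen_power x k @ replicate n (x, b)) @ [(x,
        b)]) (gen_power x (if b then k + int n else k - int n) @ [(x, b)])"
      by (rule pres_eq_append_right[OF Suc])
    also note pres_eq_gen_power_step
    finally have "pres_eq r (gen_power x k @ replicate n (x, b) @ [(x, b)])
        (gen_power x (if b then k + int (Suc n) else k - int (Suc n)))"
      by (cases b) (simp_all add: algebra_simps)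
    then show ?case by (simp add: replicate_append_same)
  qed (simp add: pres_eq.refl)
  show ?thesis
    using nat[of "nat l" True] nat[of "nat (- l)" False] by (auto simp: gen_power_def[of x l])
qed

definition bs_rels :: "int \<Rightarrow> (bs_gen word \<times> bs_gen word) set" where
  "bs_rels N = {(gen_power Gen_t 1 @ gen_power Gen_a N @ gen_power Gen_t (- 1), gen_power Gen_a N)}"

lemma BS_eq: "BS N N = presented_group (bs_rels N)"
  by (simp add: BS_def bs_rels_def)

lemma gen_power_1: "gen_power x 1 = [(x, True)]" "gen_power x (- 1) = [(x, False)]"
  by (simp_all add: gen_power_def)

lemma pres_eq_conj_commute:
  assumes "pres_eq r (u @ v @ u') v" "pres_eq r (u' @ u) []"
  shows "pres_eq r (u @ v) (v @ u)"
proof -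
  have "pres_eq r (u @ v @ u' @ u) (u @ v)"
    using pres_eq_context[OF assms(2), of "u @ v" "[]"] by simp
  moreover have "pres_eq r (u @ v @ u' @ u) (v @ u)"
    using pres_eq_append_right[OF assms(1), of u] by simp
  ultimately show ?thesis by (meson pres_eq.trans pres_eq.sym)
qed

lemma pres_eq_commute_inverse:
  assumes "pres_eq r (u @ v) (v @ u)" "pres_eq r (u' @ u) []" "pres_eq r (u @ u') []"
  shows "pres_eq r (u' @ v) (v @ u')"
proof (rule pres_eq_conj_commute[OF _ assms(3)])
  have "pres_eq r (u' @ (v @ u)) (u' @ (u @ v))"
    by (rule pres_eq_append_left[OF pres_eq.sym[OF assms(1)]])
  also have "pres_eq r (u' @ (u @ v)) v"
    using pres_eq_append_right[OF assms(2), of v] by simp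
  finally show "pres_eq r (u' @ v @ u) v" .
qed

text \<open>As multiples of \<open>N\<close> in the exponent pass through t, only a residue has to
  be stored before each stacked letter.\<close>

lemma central_power: "pres_eq (bs_rels N) (gen_power Gen_a (N * k) @ [(Gen_t, b)]) ([(Gen_t,
    b)] @ gen_power Gen_a (N * k))"
proof -
  let ?r = "bs_rels N"
  have "pres_eq ?r ([] @ (gen_power Gen_t 1 @ gen_power Gen_a N @ gen_power Gen_t (- 1)) @ []) ([] @ gen_power
      Gen_a N @ [])"
    by (rule pres_eq.rel) (simp add: bs_rels_def)
  then have "pres_eq ?r ([(Gen_t, True)] @ gen_power Gen_a N @ [(Gen_t, False)]) (gen_power Gen_a N)"
    by (simp add: gen_power_1)
  then have T: "pres_eq ?r ([(Gen_t, True)] @ gen_power Gen_a N) (gen_power Gen_a N @ [(Gen_t, True)])"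
    by (rule pres_eq_conj_commute) (use pres_eq_cancel2[of ?r Gen_t False] in simp)
  have "pres_eq ?r ([(Gen_t, b)] @ gen_power Gen_a N) (gen_power Gen_a N @ [(Gen_t, b)])"
    using T pres_eq_commute_inverse[OF T, of "[(Gen_t, False)]"]
      pres_eq_cancel2[of ?r Gen_t False] pres_eq_cancel2[of ?r Gen_t True] by (cases b) simp_all
  then have base: "pres_eq ?r (gen_power Gen_a N @ [(Gen_t, b)]) ([(Gen_t, b)] @ gen_power Gen_a N)"
    by (rule pres_eq.sym)
  have inv: "pres_eq ?r (gen_power Gen_a k @ gen_power Gen_a l) []" if "l = - k" for k l
    using gen_power_add[of ?r Gen_a k l] that by simp
  have nat: "pres_eq ?r (gen_power Gen_a (N * int n) @ [(Gen_t, b)]) ([(Gen_t,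
      b)] @ gen_power Gen_a (N * int n))" for n
  proof (induction n)
    case (Suc n)
    let ?A = "gen_power Gen_a (N * int n)" and ?B = "gen_power Gen_a N" and ?t = "[(Gen_t, b)]"
    have e: "pres_eq ?r (?A @ ?B) (gen_power Gen_a (N * int (Suc n)))"
      using gen_power_add[of ?r Gen_a "N * int n" N] by (simp add: algebra_simps)
    have "pres_eq ?r (gen_power Gen_a (N * int (Suc n)) @ ?t) ((?A @ ?B) @ ?t)"
      by (rule pres_eq_append_right[OF pres_eq.sym[OF e]])
    also have "pres_eq ?r ((?A @ ?B) @ ?t) (?A @ ?t @ ?B)"
      using pres_eq_append_left[OF base, of ?A] by simp
    also have "pres_eq ?r (?A @ ?t @ ?B) (?t @ ?A @ ?B)"
      using pres_eq_append_right[OF Suc, of ?B] by simp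
    also have "pres_eq ?r (?t @ ?A @ ?B) (?t @ gen_power Gen_a (N * int (Suc n)))"
      by (rule pres_eq_append_left[OF e])
    finally show ?case .
  qed (simp add: pres_eq.refl)
  show ?thesis
  proof (cases "k \<ge> 0")
    case True
    then show ?thesis using nat[of "nat k"] by simp
  next
    case False
    then show ?thesis
      by (intro pres_eq_commute_inverse[OF nat[of "nat (- k)"]] inv) simp_all
  qed
qed

text \<open>A stack with entries \<open>(i\<^sub>r, g\<^sub>r, e\<^sub>r), \<dots>, (i\<^sub>1, g\<^sub>1, e\<^sub>1)\<close>, top first, and a counter \<open>j\<close> encode the
  normal form \<open>a\<close> to the \<open>i\<^sub>1\<close>, \<open>g\<^sub>1\<close> to the \<open>\<plusminus>1\<close>, and so on, \<open>g\<^sub>r\<close> to the \<open>\<plusminus>1\<close>, \<open>a\<close> to the \<open>j\<close>.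
  Entries with negative \<open>i\<close> are padding at the bottom. For \<open>N = 0\<close> the group is free: both generators are
  stacked, and \<open>i\<close> and \<open>j\<close> stay \<open>0\<close>.\<close>

type_synonym entry = "int \<times> bs_gen \<times> bool"

text \<open>The modulus 1 for \<open>N = 0\<close> forces all residues to be 0, so the free group is
  covered by the same step function.\<close>

definition cap :: "int \<Rightarrow> int" where
  "cap N = (if N = 0 then 1 else \<bar>N\<bar>)"

definition cancels :: "bs_gen \<times> bool \<Rightarrow> entry list \<Rightarrow> bool" where
  "cancels l \<sigma> \<longleftrightarrow> \<sigma> \<noteq> [] \<and> 0 \<le> fst (hd \<sigma>) \<and> snd (hd \<sigma>) = (fst l, \<not> snd l)"

text \<open>Right multiplication of a normal form by \<open>l\<close>. A stacked letter keeps the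
  residue of the exponent before it and lets the central multiple of \<open>N\<close> pass to its
  right. If the residue is 0 and the top letter is inverse to \<open>l\<close>, both vanish and the
  exponent stored under them joins the counter.\<close>

definition mstep :: "int \<Rightarrow> bs_gen \<times> bool \<Rightarrow> entry list \<times> int \<Rightarrow> entry list \<times> int" where
  "mstep N l = (\<lambda>(\<sigma>, j).
     if N \<noteq> 0 \<and> fst l = Gen_a then (\<sigma>, if snd l then j + 1 else j - 1)
     else if j mod cap N = 0 \<and> cancels l \<sigma> then (tl \<sigma>, j + fst (hd \<sigma>))
     else ((j mod cap N, l) # \<sigma>, j - j mod cap N))"

definition pad :: entry where
  "pad = (- 1, Gen_a, True)"

definition entries :: "int \<Rightarrow> entry set" where
  "entries N = insert pad ({0..<cap N} \<times> UNIV \<times> UNIV)"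

text \<open>Britton's condition: stored exponents are residues, so only residue 0 between inverse
  letters can give a pinch.\<close>

fun reduced :: "entry list \<Rightarrow> bool" where
  "reduced [] = True"
| "reduced (x # \<sigma>) = (\<not> (fst x = 0 \<and> cancels (snd x) \<sigma>) \<and> reduced \<sigma>)"

definition configs :: "int \<Rightarrow> (entry list \<times> int) set" where
  "configs N = {(\<sigma>, j). set \<sigma> \<subseteq> entries N \<and> reduced \<sigma> \<and> (N = 0 \<longrightarrow> j = 0)}"

lemma cap_pos: "cap N > 0"
  by (simp add: cap_def)

lemma mod_entry: "(j mod cap N, l) \<in> entries N"
  using cap_pos[of N] by (cases l) (simp add: entries_def)

lemma mstep_entries: "set \<sigma> \<subseteq> entries N \<Longrightarrow> set (fst (mstep N l (\<sigma>, j))) \<subseteq> entries N"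
  using mod_entry[of j N l] by (cases \<sigma>) (auto simp: mstep_def)

lemma cancels_entry:
  assumes "set \<sigma> \<subseteq> entries N" "cancels l \<sigma>"
  obtains i \<sigma>' where "\<sigma> = (i, fst l, \<not> snd l) # \<sigma>'" "0 \<le> i" "i < cap N"
  using assms by (cases \<sigma>) (auto simp: cancels_def entries_def pad_def)

lemma mstep_configs: "c \<in> configs N \<Longrightarrow> mstep N l c \<in> configs N"
proof -
  assume c: "c \<in> configs N"
  obtain \<sigma> j where c_eq: "c = (\<sigma>, j)" by (cases c)
  have \<sigma>: "set \<sigma> \<subseteq> entries N" "reduced \<sigma>" "N = 0 \<Longrightarrow> j = 0" using c by (auto simp: configs_def c_eq)
  have "reduced (fst (mstep N l (\<sigma>, j)))"
    using \<sigma>(2) by (cases \<sigma>) (auto simp: mstep_def)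
  moreover have "snd (mstep N l (\<sigma>, j)) = 0" if "N = 0"
  proof -
    have "fst (hd \<sigma>) = 0" if "cancels l \<sigma>"
      using \<sigma>(1) that by (rule cancels_entry) (simp add: \<open>N = 0\<close> cap_def)
    then show ?thesis using \<sigma>(3) that by (simp add: mstep_def)
  qed
  ultimately show ?thesis
    using mstep_entries[OF \<sigma>(1), of l j] unfolding configs_def c_eq by (cases "mstep N l (\<sigma>, j)") auto
qed

text \<open>A pushed entry meets residue 0 and its inverse letter, hence is popped again. After a
  pop the counter has residue \<open>i\<close>, so the old entry is rebuilt, unless another
  cancellation occurs; reducedness excludes that.\<close>

lemma mstep_cancel:
  assumes "c \<in> configs N"
  shows "mstep N (x, \<not> b) (mstep N (x, b) c) = c"
proof -
  obtain \<sigma> j where c: "c = (\<sigma>, j)" by (cases c)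
  have \<sigma>: "set \<sigma> \<subseteq> entries N" "reduced \<sigma>" using assms by (auto simp: configs_def c)
  show ?thesis
  proof (cases "N \<noteq> 0 \<and> x = Gen_a")
    case True
    then show ?thesis by (simp add: mstep_def c)
  next
    case x: False
    show ?thesis
    proof (cases "j mod cap N = 0 \<and> cancels (x, b) \<sigma>")
      case True
      then obtain i \<sigma>' where i: "\<sigma> = (i, x, \<not> b) # \<sigma>'" "0 \<le> i" "i < cap N"
        using cancels_entry[OF \<sigma>(1), of "(x, b)"] by auto
      have "(j + i) mod cap N = i" using True i by (metis mod_add_left_eq add_0 mod_pos_pos_trivial)
      moreover have "\<not> (i = 0 \<and> cancels (x, \<not> b) \<sigma>')" using \<sigma>(2) i(1) by simp
      ultimately show ?thesis using x True i(1) by (auto simp: mstep_def c)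
    next
      case False
      have "(j - j mod cap N) mod cap N = 0" by (simp add: minus_mod_eq_mult_div)
      then show ?thesis using x False cap_pos[of N] by (auto simp: mstep_def c cancels_def)
    qed
  qed
qed

lemma fold_gen_power_a:
  "N \<noteq> 0 \<Longrightarrow> fold (mstep N) (gen_power Gen_a k) (\<sigma>, j) = (\<sigma>, j + k)"
proof -
  assume N: "N \<noteq> 0"
  have "fold (mstep N) (replicate n (Gen_a, b)) (\<sigma>, j) = (\<sigma>, if b then j + int n else j - int n)" for n b j
    using N by (induction n arbitrary: j) (auto simp: mstep_def)
  then show ?thesis by (simp add: gen_power_def)
qed

lemma mstep_shift: "mstep N l (\<sigma>, j + cap N * c) = (fst (mstep N l (\<sigma>, j)), snd (mstep N l (\<sigma>, j)) + cap N * c)"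
  by (auto simp: mstep_def)

text \<open>For nonzero \<open>N\<close> the middle factor shifts the counter by a multiple of
  \<open>cap N\<close>, which commutes with every step, and the two t-steps undo each other. For
  \<open>N = 0\<close> only the latter remains.\<close>

lemma fold_mstep_rel:
  assumes c: "c \<in> configs N"
  shows "fold (mstep N) (gen_power Gen_t 1 @ gen_power Gen_a N @ gen_power Gen_t (- 1)) c
      = fold (mstep N) (gen_power Gen_a N) c"
proof (cases "N = 0")
  case True
  then show ?thesis using mstep_cancel[OF c, of Gen_t True] by (simp add: gen_power_1)
next
  case False
  obtain \<sigma> j where c_eq: "c = (\<sigma>, j)" by (cases c)
  obtain \<sigma>' j' where m: "mstep N (Gen_t, True) c = (\<sigma>', j')" by (cases "mstep N (Gen_t, True) c")
  have "N = cap N * sgn N" using False by (simp add: cap_def abs_mult_sgn)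
  then have "mstep N (Gen_t, False) (\<sigma>', j' + N) = (fst (mstep N (Gen_t, False) (\<sigma>', j')), snd (mstep N (Gen_t,
      False) (\<sigma>', j')) + N)"
    using mstep_shift[of N "(Gen_t, False)" \<sigma>' j' "sgn N"] by simp
  also have "mstep N (Gen_t, False) (\<sigma>', j') = c"
    using mstep_cancel[OF c, of Gen_t True] m by simp
  finally show ?thesis using False m by (simp add: gen_power_1 fold_gen_power_a c_eq)
qed

lemma fold_mstep_configs: "c \<in> configs N \<Longrightarrow> fold (mstep N) u c \<in> configs N"
  by (induction u arbitrary: c) (simp_all add: mstep_configs)

text \<open>The machine thus defines a right action of the group on configurations, which makes
  normal forms unique without a separate confluence argument.\<close>

lemma pres_eq_fold_mstep:
  "pres_eq (bs_rels N) u v \<Longrightarrow> c \<in> configs N \<Longrightarrow> fold (mstep N) u c = fold (mstep N) v c"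
proof (induction arbitrary: c rule: pres_eq.induct)
  case (cancel u x b v)
  then show ?case using mstep_cancel[OF fold_mstep_configs] by simp
next
  case (rel l r u v)
  then show ?case using fold_mstep_rel[OF fold_mstep_configs[OF rel.prems, of u]]
    by (simp add: bs_rels_def)
qed auto

section \<open>Configurations read as group elements\<close>

fun stack_word :: "entry list \<Rightarrow> bs_gen word" where
  "stack_word [] = []"
| "stack_word ((i, l) # \<sigma>) = stack_word \<sigma> @ (if 0 \<le> i then gen_power Gen_a i @ [l] else [])"

definition config_word :: "entry list \<times> int \<Rightarrow> bs_gen word" where
  "config_word = (\<lambda>(\<sigma>, j). stack_word \<sigma> @ gen_power Gen_a j)"

lemma cap_dvd_commute:
  assumes "cap N dvd j" "N = 0 \<Longrightarrow> j = 0" "N \<noteq> 0 \<Longrightarrow> fst l = Gen_t"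
  shows "pres_eq (bs_rels N) (gen_power Gen_a j @ [l]) ([l] @ gen_power Gen_a j)"
proof (cases "N = 0")
  case True
  then show ?thesis using assms by (simp add: pres_eq.refl)
next
  case False
  then obtain k where "j = N * k" using assms(1) by (auto simp: cap_def)
  then show ?thesis using central_power[of N k "snd l"] assms(3) False by (cases l) auto
qed

text \<open>The converse direction: a configuration determines a group element, and a step
  multiplies it by the letter read. Popping uses the centrality of the current exponent to bring the
  inverse letters together.\<close>

lemma config_word_mstep:
  assumes c: "c \<in> configs N"
  shows "pres_eq (bs_rels N) (config_word c @ [l]) (config_word (mstep N l c))"
proof -
  let ?r = "bs_rels N"
  obtain \<sigma> j where c_eq: "c = (\<sigma>, j)" by (cases c)
  have \<sigma>: "set \<sigma> \<subseteq> entries N" "N = 0 \<Longrightarrow> j = 0" using c by (auto simp: configs_def c_eq)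
  show ?thesis
  proof (cases "N \<noteq> 0 \<and> fst l = Gen_a")
    case True
    then show ?thesis
      using pres_eq_append_left[OF pres_eq_gen_power_step[of ?r Gen_a j "snd l"], of "stack_word \<sigma>"]
      by (cases l) (simp add: config_word_def c_eq mstep_def)
  next
    case x: False
    then have lt: "fst l = Gen_t" if "N \<noteq> 0" using that by (cases "fst l") auto
    define i where "i = j mod cap N"
    have split: "pres_eq ?r (gen_power Gen_a j @ [l]) (gen_power Gen_a i @ [l] @ gen_power Gen_a (j - i))"
    proof -
      have "pres_eq ?r (gen_power Gen_a j @ [l]) ((gen_power Gen_a i @ gen_power Gen_a (j - i)) @ [l])"
        using pres_eq_append_right[OF pres_eq.sym[OF gen_power_add[of ?r Gen_a i "j - i"]]] by simp
      also have "pres_eq ?r (gen_power Gen_a (j - i) @ [l]) ([l] @ gen_power Gen_a (j - i))"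
        using \<sigma>(2) lt by (intro cap_dvd_commute) (auto simp: i_def minus_mod_eq_mult_div)
      then have "pres_eq ?r ((gen_power Gen_a i @ gen_power Gen_a (j - i)) @ [l]) (gen_power Gen_a i @ [l] @
          gen_power Gen_a (j - i))"
        using pres_eq_append_left[of ?r _ _ "gen_power Gen_a i"] by simp
      finally show ?thesis .
    qed
    show ?thesis
    proof (cases "i = 0 \<and> cancels l \<sigma>")
      case True
      then obtain i' \<sigma>' where i': "\<sigma> = (i', fst l, \<not> snd l) # \<sigma>'" "0 \<le> i'"
        using cancels_entry[OF \<sigma>(1)] by blast
      have "pres_eq ?r (stack_word \<sigma> @ gen_power Gen_a j @ [l])
          ((stack_word \<sigma>' @ gen_power Gen_a i') @ ([(fst l, \<not> snd l)] @ [(fst l, \<not> \<not> snd l)]) @ gen_power Gen_a j)"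
        using pres_eq_append_left[OF split, of "stack_word \<sigma>"] True i' by simp
      also have "pres_eq ?r \<dots> ((stack_word \<sigma>' @ gen_power Gen_a i') @ [] @ gen_power Gen_a j)"
        by (rule pres_eq_context[OF pres_eq_cancel2])
      also have "pres_eq ?r \<dots> (stack_word \<sigma>' @ gen_power Gen_a (j + i'))"
        using pres_eq_append_left[OF gen_power_add[of ?r Gen_a i' j], of "stack_word \<sigma>'"] by (simp add: add.commute)
      finally show ?thesis
        using x True i' by (auto simp: config_word_def c_eq mstep_def i_def)
    next
      case False
      have "0 \<le> i" using cap_pos[of N] by (simp add: i_def)
      then show ?thesis
        using x False pres_eq_append_left[OF split, of "stack_word \<sigma>"]
        by (auto simp: config_word_def c_eq mstep_def i_def)
    qed
  qed
qed

lemma config_word_fold: "c \<in> configs N \<Longrightarrow> pres_eq (bs_rels N) (config_word c @ u) (config_word (fold (mstep N) u c))"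
proof (induction u arbitrary: c)
  case (Cons l u)
  have "pres_eq (bs_rels N) ((config_word c @ [l]) @ u) (config_word (mstep N l c) @ u)"
    by (rule pres_eq_append_right[OF config_word_mstep[OF Cons.prems]])
  also have "pres_eq (bs_rels N) \<dots> (config_word (fold (mstep N) u (mstep N l c)))"
    by (rule Cons.IH[OF mstep_configs[OF Cons.prems]])
  finally show ?case by simp
qed (simp add: pres_eq.refl)

lemma pads_configs: "(replicate n pad, 0) \<in> configs N"
proof -
  have "reduced (replicate n pad)" by (induction n) (auto simp: pad_def)
  then show ?thesis by (auto simp: configs_def entries_def)
qed

text \<open>The number of pads is arbitrary, so it can later be taken as large as the reading depth
  requires.\<close>

lemma pres_eq_Nil_iff:
  "pres_eq (bs_rels N) u [] \<longleftrightarrow> fold (mstep N) u (replicate n pad, 0) = (replicate n pad, 0)"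
proof
  assume "pres_eq (bs_rels N) u []"
  then show "fold (mstep N) u (replicate n pad, 0) = (replicate n pad, 0)"
    using pres_eq_fold_mstep[OF _ pads_configs, of N u "[]"] by simp
next
  have w: "config_word (replicate n pad, 0) = []"
    by (induction n) (simp_all add: config_word_def pad_def)
  assume "fold (mstep N) u (replicate n pad, 0) = (replicate n pad, 0)"
  then show "pres_eq (bs_rels N) u []"
    using config_word_fold[OF pads_configs[of n N], of u] by (simp add: w)
qed

section \<open>Locality, growth and padding of the machine\<close>

lemma mstep_local: "\<tau> \<noteq> [] \<Longrightarrow> mstep N l (\<tau> @ \<rho>, j) = (fst (mstep N l (\<tau>, j)) @ \<rho>, snd (mstep N l (\<tau>, j)))"
  by (auto simp: mstep_def cancels_def)

lemma mstep_length:
  "length (fst (mstep N l (\<tau>, j))) \<le> length \<tau> + 1" "length \<tau> \<le> length (fst (mstep N l (\<tau>, j))) + 1"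
  by (auto simp: mstep_def)

lemma mstep_bound: "j - cap N \<le> snd (mstep N l (\<tau>, j))"
proof -
  have "j mod cap N \<le> cap N" "1 \<le> cap N" using cap_pos[of N] by (simp_all add: order_less_imp_le)
  then show ?thesis by (auto simp: mstep_def cancels_def)
qed

text \<open>The negative first component of \<open>pad\<close> makes \<open>cancels\<close> fail, so
  the padding is never consumed.\<close>

lemma mstep_pads: "\<exists>s'. fst (mstep N l (s @ replicate n pad, j)) = s' @ replicate n pad"
proof (cases "s = []")
  case True
  have "\<not> cancels l (replicate n pad)" by (cases n) (auto simp: cancels_def pad_def)
  then show ?thesis using True by (auto simp: mstep_def intro: exI[of _ "[]"] exI[of _ "[y]" for y])
next
  case False
  then show ?thesis by (simp add: mstep_local)
qed

text \<open>Each letter consumes at most one entry, so a word no longer than the visible part never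
  has to look below it.\<close>

lemma fold_mstep_local: "length u \<le> length \<tau> \<Longrightarrow>
    fold (mstep N) u (\<tau> @ \<rho>, j) = (fst (fold (mstep N) u (\<tau>, j)) @ \<rho>, snd (fold (mstep N) u (\<tau>, j)))"
proof (induction u arbitrary: \<tau> j)
  case (Cons l u)
  then have "mstep N l (\<tau> @ \<rho>, j) = (fst (mstep N l (\<tau>, j)) @ \<rho>, snd (mstep N l (\<tau>, j)))"
    by (intro mstep_local) auto
  then show ?case
    using Cons.IH[of "fst (mstep N l (\<tau>, j))" "snd (mstep N l (\<tau>, j))"] Cons.prems mstep_length(2)[of \<tau> N l j]
    by simp
qed simp

lemma fold_mstep_length: "length (fst (fold (mstep N) u (\<tau>, j))) \<le> length \<tau> + length u"
proof (induction u arbitrary: \<tau> j)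
  case (Cons l u)
  then show ?case
    using Cons.IH[of "fst (mstep N l (\<tau>, j))" "snd (mstep N l (\<tau>, j))"] mstep_length(1)[of N l \<tau> j] by simp
qed simp

lemma fold_mstep_entries: "set \<tau> \<subseteq> entries N \<Longrightarrow> set (fst (fold (mstep N) u (\<tau>, j))) \<subseteq> entries N"
proof (induction u arbitrary: \<tau> j)
  case (Cons l u)
  then show ?case
    using Cons.IH[OF mstep_entries[OF Cons.prems, of l j], of "snd (mstep N l (\<tau>, j))"] by simp
qed simp

lemma fold_mstep_shift: "fold (mstep N) u (\<tau>, j + cap N * c) =
    (fst (fold (mstep N) u (\<tau>, j)), snd (fold (mstep N) u (\<tau>, j)) + cap N * c)"
proof (induction u arbitrary: \<tau> j)
  case (Cons l u)
  then show ?case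
    using Cons.IH[of "fst (mstep N l (\<tau>, j))" "snd (mstep N l (\<tau>, j))"] by (simp add: mstep_shift)
qed simp

lemma fold_mstep_bound: "j - cap N * int (length u) \<le> snd (fold (mstep N) u (\<tau>, j))"
proof (induction u arbitrary: \<tau> j)
  case (Cons l u)
  then show ?case
    using Cons.IH[of "snd (mstep N l (\<tau>, j))" "fst (mstep N l (\<tau>, j))"] mstep_bound[of j N l \<tau>]
    by (simp add: algebra_simps)
qed simp

lemma fold_mstep_pads: "\<exists>s'. fst (fold (mstep N) u (s @ replicate n pad, j)) = s' @ replicate n pad"
proof (induction u arbitrary: s j)
  case (Cons l u)
  obtain s' where "fst (mstep N l (s @ replicate n pad, j)) = s' @ replicate n pad"
    using mstep_pads[of N l s n j] by blast
  then show ?case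
    using Cons.IH[of s' "snd (mstep N l (s @ replicate n pad, j))"] by (cases "mstep N l (s @ replicate n pad,
        j)") simp
qed simp

lemma fold_fold_concat: "fold (\<lambda>x. fold f (g x)) w = fold f (concat (map g w))"
  by (induction w) (simp_all add: fun_eq_iff)

text \<open>A letter of \<open>X\<close> spells at most \<open>L\<close> generators. Each of them
  removes or adds at most one entry and lowers the counter by at most \<open>cap N\<close>, whence
  the constant \<open>cap N * int L\<close>; being a multiple of \<open>cap N\<close>, it is also a
  period.\<close>

lemma local_action_words:
  assumes "finite X" "L > 0" and len: "\<And>x. x \<in> X \<Longrightarrow> length (\<omega> x) \<le> L"
  shows "local_action X (entries N) (\<lambda>x. fold (mstep N) (\<omega> x)) L (cap N * int L) (replicate L pad)"
proof
  show "finite X" "L > 0" "0 < cap N * int L" using assms cap_pos[of N] by auto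
  have "finite (UNIV :: bs_gen set)"
    by (rule finite_subset[of _ "{Gen_a, Gen_t}"]) (auto intro: bs_gen.exhaust)
  then have "finite (UNIV :: (bs_gen \<times> bool) set)" by (rule finite_Prod_UNIV) simp
  then show "finite (entries N)" by (simp add: entries_def)
  show "length (replicate L pad) = L" "set (replicate L pad) \<subseteq> entries N" by (auto simp: entries_def)
next
  fix x and \<tau> \<rho> :: "entry list" and j assume "x \<in> X" "L \<le> length \<tau>"
  then show "fold (mstep N) (\<omega> x) (\<tau> @ \<rho>, j) = (fst (fold (mstep N) (\<omega> x) (\<tau>, j)) @ \<rho>,
      snd (fold (mstep N) (\<omega> x) (\<tau>, j)))"
    using len[of x] by (intro fold_mstep_local) auto
next
  fix x and \<tau> :: "entry list" and j assume "x \<in> X"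
  then show "length (fst (fold (mstep N) (\<omega> x) (\<tau>, j))) \<le> length \<tau> + L"
    using len[of x] fold_mstep_length[of N "\<omega> x" \<tau> j] by linarith
next
  fix x and \<tau> :: "entry list" and j assume "set \<tau> \<subseteq> entries N"
  then show "set (fst (fold (mstep N) (\<omega> x) (\<tau>, j))) \<subseteq> entries N" by (rule fold_mstep_entries)
next
  fix x and \<tau> :: "entry list" and j c
  show "fold (mstep N) (\<omega> x) (\<tau>, j + cap N * int L * c) =
      (fst (fold (mstep N) (\<omega> x) (\<tau>, j)), snd (fold (mstep N) (\<omega> x) (\<tau>, j)) + cap N * int L * c)"
    using fold_mstep_shift[of N "\<omega> x" \<tau> j "int L * c"] by (simp add: mult.assoc)
next
  fix x and \<tau> :: "entry list" and j assume "x \<in> X"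
  then have "cap N * int (length (\<omega> x)) \<le> cap N * int L"
    using len[of x] cap_pos[of N] by (intro mult_left_mono) auto
  then show "j - cap N * int L \<le> snd (fold (mstep N) (\<omega> x) (\<tau>, j))"
    using fold_mstep_bound[of j N "\<omega> x" \<tau>] by linarith
next
  fix w
  obtain s' where "fst (fold (mstep N) (concat (map \<omega> w)) ([] @ replicate L pad, 0)) = s' @ replicate L pad"
    using fold_mstep_pads by blast
  then show "L \<le> length (fst (fold (\<lambda>x. fold (mstep N) (\<omega> x)) w (replicate L pad, 0)))"
    by (simp add: fold_fold_concat)
qed

section \<open>From generators to an arbitrary generating set\<close>

lemma word_value_presented_group:
  assumes "\<And>x. x \<in> set w \<Longrightarrow> x = pres_class r (\<omega> x)"
  shows "word_value (presented_group r) w = pres_class r (concat (map \<omega> w))"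
  using assms
proof (induction w)
  case Nil
  show ?case by (simp add: word_value_def presented_group_def)
next
  case (Cons x w)
  have "word_value (presented_group r) (x # w) = x \<otimes>\<^bsub>presented_group r\<^esub> pres_class r (concat (map \<omega> w))"
    using Cons by (simp add: word_value_def)
  also have "\<dots> = pres_class r (\<omega> x) \<otimes>\<^bsub>presented_group r\<^esub> pres_class r (concat (map \<omega> w))"
    using Cons.prems[of x] by simp
  finally show ?case by (simp add: presented_group_mult)
qed

theorem corollaryA1:
  fixes N :: int
    and X :: "bs_gen word set set"
    and R :: "bs_gen word set list set"
  assumes "finite X"
    and "monoid_generating_set (BS N N) X"
    and "regular_language X R"
  shows "\<exists>(p :: nat) (r :: monomial \<Rightarrow> rat).
           p \<ge> 1 \<and> rational_mps p r \<and> cogrowth_series (BS N N) R = diagonal p r"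
proof -
  let ?r = "bs_rels N"
  define \<omega> where "\<omega> x = (SOME u. x = pres_class ?r u)" for x
  have \<omega>: "x = pres_class ?r (\<omega> x)" if "x \<in> X" for x
  proof -
    have "\<exists>u. x = pres_class ?r u"
      using assms(2) that by (auto simp: monoid_generating_set_def BS_eq presented_group_def)
    then show ?thesis unfolding \<omega>_def by (rule someI_ex)
  qed
  \<comment> \<open>The sum bounds the length of every chosen word, and the successor keeps
    \<open>L\<close> positive even if all of them are empty.\<close>
  define L where "L = Suc (\<Sum>x\<in>X. length (\<omega> x))"
  have "length (\<omega> x) \<le> L" if "x \<in> X" for x
    using member_le_sum[OF that, of "\<lambda>x. length (\<omega> x)"] assms(1) by (simp add: L_def)
  then interpret local_action X "entries N" "\<lambda>x. fold (mstep N) (\<omega> x)" L "cap N * int L" "replicate L pad"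
    using assms(1) by (intro local_action_words) (auto simp: L_def)
  obtain S :: "nat set" and q0 F \<delta> where S: "finite S" "q0 \<in> S" "F \<subseteq> S" "\<And>q x. q \<in> S \<Longrightarrow> x \<in> X \<Longrightarrow> \<delta> q x \<in> S"
    and R: "R = {w \<in> lists X. foldl \<delta> q0 w \<in> F}"
    using assms(3) unfolding regular_language_def by blast
  obtain n r where r: "rational_mps (Suc n) r" "diagonal (Suc n) r
      = Abs_fps (\<lambda>k. of_nat (card {w \<in> lists X. length w = k \<and>
      fold (\<lambda>x. fold (mstep N) (\<omega> x)) w (replicate L pad, 0) = (replicate L pad, 0) \<and> foldl \<delta> q0 w \<in> F}))"
    using local_action_diagonal[of S \<delta>, OF S(1) _ S(2,3)] S(4) by blast
  have "word_value (BS N N) w = \<one>\<^bsub>BS N N\<^esub> \<longleftrightarrow>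
      fold (\<lambda>x. fold (mstep N) (\<omega> x)) w (replicate L pad, 0) = (replicate L pad, 0)" if "w \<in> lists X" for w
  proof -
    have "word_value (BS N N) w = pres_class ?r (concat (map \<omega> w))"
      unfolding BS_eq using that \<omega> by (intro word_value_presented_group) auto
    moreover have "\<one>\<^bsub>BS N N\<^esub> = pres_class ?r []" by (simp add: BS_eq presented_group_def)
    ultimately show ?thesis
      by (simp add: pres_class_eq_iff pres_eq_Nil_iff[of N _ L] fold_fold_concat)
  qed
  then have "{w \<in> R. length w = k \<and> word_value (BS N N) w = \<one>\<^bsub>BS N N\<^esub>} = {w \<in> lists X. length w = k \<and>
      fold (\<lambda>x. fold (mstep N) (\<omega> x)) w (replicate L pad, 0) = (replicate L pad, 0) \<and> foldl \<delta> q0 w \<in> F}" for k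
    unfolding R by blast
  then have "cogrowth_series (BS N N) R = diagonal (Suc n) r"
    by (simp add: cogrowth_series_def r(2))
  then show ?thesis using r(1) by (intro exI[of _ "Suc n"] exI[of _ r]) simp
qed

end
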